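(* A finite nilpotent group is a $2$-closed group if and only if it is cyclic or it is isomorphic to a direct product $Q_{2^n}\times C_m$ of a generalized quaternion group $Q_{2^n}$ ($n\geq 3$) with a cyclic group $C_m$ of odd order $m$.
   Context: Permutations act on the right; $\alpha^g$ denotes the image of $\alpha$ under $g$. For a set $\Omega$ and $G\leq{\rm Sym}(\Omega)$, the $2$-closure of $G$ on $\Omega$ is $G^{(2),\Omega}=\{\theta\in{\rm Sym}(\Omega)\mid \forall \alpha,\beta\in\Omega\ \exists g\in G:\ \alpha^\theta=\alpha^g,\ \beta^\theta=\beta^g\}$. An abstract group $G$ is called a $2$-closed group if $H=H^{(2),\Omega}$ for every set $\Omega$ and every subgroup $H\leq{\rm Sym}(\Omega)$ with $H\cong G$. $Q_{2^n}$ denotes the generalized quaternion group of order $2^n$, $n\geq 3$, and $C_m$ the cyclic group of order $m$. *)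

theory Defs
  imports "HOL-Algebra.Algebra"
begin

definition two_closure :: "'b set \<Rightarrow> ('b \<Rightarrow> 'b) set \<Rightarrow> ('b \<Rightarrow> 'b) set" where
  "two_closure \<Omega> H =
     {\<theta> \<in> Bij \<Omega>. \<forall>\<alpha>\<in>\<Omega>. \<forall>\<beta>\<in>\<Omega>. \<exists>g\<in>H. \<theta> \<alpha> = g \<alpha> \<and> \<theta> \<beta> = g \<beta>}"

definition two_closed_group :: "('a, 'c) monoid_scheme \<Rightarrow> 'b itself \<Rightarrow> bool" where
  "two_closed_group G (_ :: 'b itself) \<longleftrightarrow>
     (\<forall>(\<Omega> :: 'b set) H. subgroup H (BijGroup \<Omega>) \<and> G \<cong> ((BijGroup \<Omega>)\<lparr>carrier := H\<rparr>)
        \<longrightarrow> H = two_closure \<Omega> H)"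

fun lower_central :: "('a, 'c) monoid_scheme \<Rightarrow> nat \<Rightarrow> 'a set" where
  "lower_central G 0 = carrier G"
| "lower_central G (Suc i) =
     generate G (\<Union>x\<in>carrier G. \<Union>h\<in>lower_central G i.
                   {x \<otimes>\<^bsub>G\<^esub> h \<otimes>\<^bsub>G\<^esub> inv\<^bsub>G\<^esub> x \<otimes>\<^bsub>G\<^esub> inv\<^bsub>G\<^esub> h})"

definition nilpotent_group :: "('a, 'c) monoid_scheme \<Rightarrow> bool" where
  "nilpotent_group G \<longleftrightarrow> group G \<and> (\<exists>k. lower_central G k = {\<one>\<^bsub>G\<^esub>})"

text \<open>Generalized quaternion group of order 2^n (n >= 3):
  <x, y | x^(2^(n-1)) = 1, y^2 = x^(2^(n-2)), y^-1 x y = x^-1>,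
  modelled with the element x^i y^e represented by the pair (i, e),
  0 <= i < 2^(n-1), e in {0,1}.\<close>
definition quaternion_group :: "nat \<Rightarrow> (int \<times> int) monoid" where
  "quaternion_group n =
     \<lparr>carrier = {0..<2^(n-1)} \<times> {0..<2},
      monoid.mult = (\<lambda>(i, a) (j, b).
         ((i + (if a = 1 then - j else j) + (if a = 1 \<and> b = 1 then 2^(n-2) else 0)) mod 2^(n-1),
          (a + b) mod 2)),
      one = (0, 0)\<rparr>"

end

theory Submission
  imports Defs
begin


text \<open>Closed direction: let \<open>c\<close> generate \<open>C\<^sub>m\<close> (or the whole cyclic group). In the quaternion case
  the unique involution of the 2-part moves a point, whose stabilizer therefore lies in \<open>\<langle>c\<rangle>\<close>. So, up to an
  element of \<open>G\<close>, a permutation \<open>\<theta>\<close> in the 2-closure acts at each point as a power of \<open>c\<close>; the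
  admissible exponents form cosets in the integers that meet pairwise, and by the Helly property of
  such cosets one exponent serves all points.

  Conversely, let \<open>G\<close> be nilpotent and 2-closed. If \<open>a\<close> has prime order and lies in \<open>\<gamma>\<^sub>i\<close> but not in
  \<open>\<gamma>\<^sub>i\<^sub>+\<^sub>1\<close>, the action on the cosets of \<open>\<gamma>\<^sub>i\<^sub>+\<^sub>1\<close> and of \<open>\<langle>a\<rangle>\<close> shows that \<open>a\<close> is central. If \<open>a, b\<close> are
  central of prime order \<open>p\<close> and generate different subgroups, the action on the cosets of \<open>\<langle>a\<rangle>\<close>,
  \<open>\<langle>b\<rangle>\<close>, \<open>\<langle>ab\<rangle>\<close> is not 2-closed. So \<open>G\<close> has at most one subgroup of each prime order. A largest normal
  cyclic subgroup \<open>\<langle>c\<rangle>\<close> is then self-centralizing, and computing \<open>(c\<^sup>i g)\<^sup>q\<close> for \<open>g\<^sup>q \<in> \<langle>c\<rangle>\<close> shows that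
  any \<open>g\<close> outside \<open>\<langle>c\<rangle>\<close> squares into \<open>\<langle>c\<rangle>\<close>, inverts its 2-part and centralizes its odd part.\<close>

section \<open>Helly property of cosets in the integers\<close>

text \<open>Division with remainder by the least positive element \<open>n\<close> of
  \<open>T\<close>: a nonzero remainder would be a smaller positive element. The trivial subgroup is
  the case \<open>d = 0\<close>.\<close>

lemma int_subgroup_eq_multiples:
  fixes T :: "int set"
  assumes "0 \<in> T" and diff: "\<And>x y. x \<in> T \<Longrightarrow> y \<in> T \<Longrightarrow> x - y \<in> T"
  shows "\<exists>d. T = {x. d dvd x}"
proof (cases "T = {0}")
  case True
  then show ?thesis by (intro exI[of _ 0]) auto
next
  case False
  then obtain y where y: "y \<in> T" "y \<noteq> 0" using assms(1) by blast
  have neg: "- x \<in> T" if "x \<in> T" for x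
    using diff[OF assms(1) that] by simp
  have add: "x + z \<in> T" if "x \<in> T" "z \<in> T" for x z
    using diff[OF that(1) neg[OF that(2)]] by simp
  define n where "n = (LEAST n. 0 < n \<and> int n \<in> T)"
  have "0 < nat \<bar>y\<bar> \<and> int (nat \<bar>y\<bar>) \<in> T"
    using y neg by (auto simp: abs_if)
  then have n: "0 < n" "int n \<in> T"
    using LeastI[of "\<lambda>n. 0 < n \<and> int n \<in> T"] unfolding n_def by blast+
  have mult_nat: "int m * int n \<in> T" for m
    by (induction m) (auto simp: assms(1) add n algebra_simps)
  have mult: "k * int n \<in> T" for k
    by (cases k rule: int_cases2) (use mult_nat neg in \<open>auto simp del: of_nat_mult\<close>)
  have "int n dvd x" if "x \<in> T" for x
  proof (rule ccontr)
    assume "\<not> int n dvd x"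
    then have pos: "0 < x mod int n"
      using n(1) by (metis dvd_eq_mod_eq_0 of_nat_0_less_iff order_less_le pos_mod_sign)
    have "x mod int n = x - (x div int n) * int n"
      by (simp add: minus_div_mult_eq_mod)
    then have "x mod int n \<in> T"
      using diff[OF that mult] by simp
    then have "0 < nat (x mod int n) \<and> int (nat (x mod int n)) \<in> T"
      using pos by simp
    then have "n \<le> nat (x mod int n)"
      unfolding n_def by (rule Least_le)
    moreover have "x mod int n < int n" using n(1) by simp
    ultimately show False using pos by linarith
  qed
  moreover have "x \<in> T" if "int n dvd x" for x
    using that mult by (auto simp: mult.commute elim!: dvdE)
  ultimately show ?thesis by blast
qed

text \<open>The modulus 0 is allowed and gives single integers, the modulus 1 gives
  \<open>UNIV\<close>; the empty set is no coset.\<close>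

definition int_coset :: "int set \<Rightarrow> bool" where
  "int_coset S \<longleftrightarrow> (\<exists>a d. S = {i. d dvd i - a})"

text \<open>Closure under \<open>i - j + k\<close> describes a coset without a base point.
  Translating one member to 0 turns the set into a subgroup.\<close>

lemma int_cosetI:
  assumes "a \<in> S" and closed: "\<And>i j k. i \<in> S \<Longrightarrow> j \<in> S \<Longrightarrow> k \<in> S \<Longrightarrow> i - j + k \<in> S"
  shows "int_coset S"
proof -
  let ?T = "{x. x + a \<in> S}"
  have "\<exists>d. ?T = {x. d dvd x}"
  proof (rule int_subgroup_eq_multiples)
    show "x - y \<in> ?T" if "x \<in> ?T" "y \<in> ?T" for x y
      using closed[of "x + a" "y + a" a] that assms(1) by (simp add: algebra_simps)
  qed (use assms in auto)
  then obtain d where d: "?T = {x. d dvd x}" by blast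
  have "i \<in> S \<longleftrightarrow> d dvd i - a" for i
  proof -
    have "i \<in> S \<longleftrightarrow> i - a \<in> ?T" by simp
    then show ?thesis unfolding d by simp
  qed
  then have "S = {i. d dvd i - a}" by blast
  then show ?thesis unfolding int_coset_def by blast
qed

lemma int_coset_shift:
  assumes "int_coset S" "a \<in> S"
  obtains d where "S = {i. d dvd i - a}"
proof -
  obtain b d where S: "S = {i. d dvd i - b}" using assms(1) unfolding int_coset_def by blast
  have d: "d dvd a - b" using assms(2) S by simp
  have "d dvd i - b \<longleftrightarrow> d dvd i - a" for i
    using dvd_add_left_iff[OF d, of "i - a"] by simp
  then show ?thesis using S that by simp
qed

text \<open>The Chinese remainder theorem for moduli that need not be coprime; a Bezout identity for
  \<open>d\<close> and \<open>f\<close> yields the common member.\<close>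

lemma int_cosets_meet_iff:
  fixes a b d f :: int
  shows "{i. d dvd i - a} \<inter> {i. f dvd i - b} \<noteq> {} \<longleftrightarrow> gcd d f dvd b - a"
proof
  assume "{i. d dvd i - a} \<inter> {i. f dvd i - b} \<noteq> {}"
  then obtain i where "d dvd i - a" "f dvd i - b" by blast
  then have "gcd d f dvd (i - a) - (i - b)"
    by (blast intro: dvd_diff dvd_trans gcd_dvd1 gcd_dvd2)
  then show "gcd d f dvd b - a" by simp
next
  assume "gcd d f dvd b - a"
  then obtain k where k: "b - a = gcd d f * k" by blast
  obtain u v where uv: "u * d + v * f = gcd d f" using bezout_int by blast
  have "b - a = k * u * d + k * v * f"
    by (metis k uv mult.commute mult.assoc distrib_left)
  then have "(a + k * u * d) - b = - (k * v) * f" by (simp add: algebra_simps)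
  then have "a + k * u * d \<in> {i. d dvd i - a} \<inter> {i. f dvd i - b}"
    by simp
  then show "{i. d dvd i - a} \<inter> {i. f dvd i - b} \<noteq> {}" by blast
qed

text \<open>Triples reduce to the distributivity of \<open>gcd\<close> over \<open>lcm\<close>.\<close>

lemma int_cosets_Helly3:
  assumes "int_coset S" "int_coset T" "int_coset U"
    and ST: "S \<inter> T \<noteq> {}" and SU: "S \<inter> U \<noteq> {}" and TU: "T \<inter> U \<noteq> {}"
  shows "int_coset (S \<inter> T)" and "S \<inter> T \<inter> U \<noteq> {}"
proof -
  obtain a where a: "a \<in> S" "a \<in> T" using ST by blast
  obtain d where S: "S = {i. d dvd i - a}" by (rule int_coset_shift[OF assms(1) a(1)])
  obtain f where T: "T = {i. f dvd i - a}" by (rule int_coset_shift[OF assms(2) a(2)])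
  obtain b h where U: "U = {i. h dvd i - b}" using assms(3) unfolding int_coset_def by blast
  have eq: "S \<inter> T = {i. lcm d f dvd i - a}" unfolding S T by auto
  then show "int_coset (S \<inter> T)" unfolding int_coset_def by blast
  have "lcm (gcd d h) (gcd f h) dvd b - a"
    using SU TU unfolding S T U int_cosets_meet_iff by (rule lcm_least)
  moreover have "gcd (lcm d f) h = lcm (gcd d h) (gcd f h)"
    by (metis gcd_lcm_distrib gcd.commute)
  ultimately show "S \<inter> T \<inter> U \<noteq> {}"
    unfolding eq U int_cosets_meet_iff by simp
qed

lemma int_cosets_Helly:
  assumes "finite F" "\<And>S. S \<in> F \<Longrightarrow> int_coset S"
    and "\<And>S T. S \<in> F \<Longrightarrow> T \<in> F \<Longrightarrow> S \<inter> T \<noteq> {}"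
  shows "\<Inter>F \<noteq> {}"
proof -
  \<comment> \<open>The induction carries an additional coset \<open>S\<close>, into which the
    members of \<open>F\<close> are absorbed one at a time; the three-coset case keeps the remaining
    intersections nonempty. At the end \<open>S\<close> is \<open>UNIV\<close>.\<close>
  have "S \<inter> \<Inter>F \<noteq> {}" if "int_coset S" "\<And>T. T \<in> F \<Longrightarrow> S \<inter> T \<noteq> {}" for S
    using assms that
  proof (induction F arbitrary: S)
    case empty
    then obtain a d where "S = {i. d dvd i - a}" unfolding int_coset_def by blast
    then have "a \<in> S" by simp
    then show ?case by auto
  next
    case (insert T F)
    have "(S \<inter> T) \<inter> \<Inter>F \<noteq> {}"
    proof (rule insert.IH)
      show "int_coset (S \<inter> T)"
        by (rule int_cosets_Helly3(1)[of S T T]) (use insert.prems insert.prems(2)[of T T] in simp_all)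
      show "S \<inter> T \<inter> U \<noteq> {}" if "U \<in> F" for U
        by (rule int_cosets_Helly3(2)) (simp_all add: insert.prems that)
    qed (use insert.prems in auto)
    then show ?case by (simp add: Int_assoc)
  qed
  from this[of UNIV] show ?thesis
    using assms int_cosetI[of 0 UNIV] by fastforce
qed

text \<open>A set with period \<open>n\<close> is determined by the residues it contains. This makes
  the family of exponent sets finite even for an infinite set of points, as the Helly property
  requires.\<close>

lemma finite_periodic_int_sets:
  assumes "n > 0"
  shows "finite {S. \<forall>i::int. i \<in> S \<longleftrightarrow> i mod n \<in> S}"
proof (rule finite_subset)
  show "{S. \<forall>i::int. i \<in> S \<longleftrightarrow> i mod n \<in> S} \<subseteq> (\<lambda>T. {i. i mod n \<in> T}) ` Pow {0..<n}"
  proof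
    fix S assume "S \<in> {S. \<forall>i::int. i \<in> S \<longleftrightarrow> i mod n \<in> S}"
    then have "S = {i. i mod n \<in> S \<inter> {0..<n}}" using assms by auto
    then show "S \<in> (\<lambda>T. {i. i mod n \<in> T}) ` Pow {0..<n}" by blast
  qed
qed simp

section \<open>Cyclic groups and quaternion times cyclic groups\<close>

lemma (in group) inv_mult_cancel_left:
  assumes "g \<in> carrier G" "x \<in> carrier G" "y \<in> carrier G"
  shows "inv (g \<otimes> x) \<otimes> (g \<otimes> y) = inv x \<otimes> y"
proof -
  have "inv g \<otimes> (g \<otimes> y) = y"
    using assms by (simp flip: m_assoc)
  then show ?thesis using assms by (simp add: inv_mult_group m_assoc)
qed

lemma (in group) int_pow_commute:
  assumes "x \<otimes> y = y \<otimes> x" "x \<in> carrier G" "y \<in> carrier G"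
  shows "x [^] (i::int) \<otimes> y = y \<otimes> x [^] i"
proof -
  have nat: "x [^] (n::nat) \<otimes> y = y \<otimes> x [^] n" for n
    using group_commutes_pow assms by blast
  show ?thesis
  proof (cases i rule: int_cases2)
    case (nonpos n)
    let ?z = "x [^] n"
    have "inv ?z \<otimes> y = inv ?z \<otimes> (y \<otimes> ?z) \<otimes> inv ?z"
      using assms by (simp add: m_assoc)
    also have "\<dots> = inv ?z \<otimes> ?z \<otimes> y \<otimes> inv ?z"
      unfolding nat[symmetric] using assms by (simp only: m_assoc nat_pow_closed inv_closed m_closed)
    finally have "inv ?z \<otimes> y = y \<otimes> inv ?z"
      using assms by simp
    then show ?thesis using nonpos assms by (simp add: int_pow_neg_int)
  qed (use nat in \<open>simp add: int_pow_int\<close>)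
qed

section \<open>The 2-closure of a group with a large central cyclic subgroup\<close>

context group_action
begin

lemma two_closure_superset: "\<phi> ` carrier G \<subseteq> two_closure E (\<phi> ` carrier G)"
  unfolding two_closure_def using bij_prop0 by blast

text \<open>Raising to the power \<open>e\<close> retracts \<open>G\<close> onto \<open>\<langle>c\<rangle>\<close>: it replaces an element of \<open>G\<close> that agrees with
  \<open>\<theta>\<close> on two points by a power of \<open>c\<close> that does.\<close>

lemma two_closure_cyclic_stabilizer:
  fixes e :: nat
  assumes fin: "finite (carrier G)" and c: "c \<in> carrier G"
    and central: "\<And>h. h \<in> carrier G \<Longrightarrow> c \<otimes> h = h \<otimes> c"
    and pow_in: "\<And>h. h \<in> carrier G \<Longrightarrow> \<exists>i::int. h [^] e = c [^] i"
    and ce: "c [^] e = c"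
    and stab: "(\<forall>h\<in>carrier G. \<exists>i::int. h = c [^] i) \<or>
               (\<exists>\<alpha>\<in>E. \<forall>h\<in>carrier G. \<phi> h \<alpha> = \<alpha> \<longrightarrow> (\<exists>i::int. h = c [^] i))"
  shows "two_closure E (\<phi> ` carrier G) \<subseteq> \<phi> ` carrier G"
proof
  interpret G: group G using group_hom group_hom.axioms(1) by blast
  have act: "\<phi> (g \<otimes> h) \<beta> = \<phi> g (\<phi> h \<beta>)" if "g \<in> carrier G" "h \<in> carrier G" "\<beta> \<in> E" for g h \<beta>
    using composition_rule that by blast
  have in_E: "\<phi> g \<beta> \<in> E" if "g \<in> carrier G" "\<beta> \<in> E" for g \<beta>
    using element_image that by blast
  have one_act: "\<phi> \<one> \<beta> = \<beta>" if "\<beta> \<in> E" for \<beta>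
    using id_eq_one that by (metis restrict_apply')
  have cancel: "\<phi> g \<beta> = \<phi> h \<beta> \<longleftrightarrow> \<phi> (inv g \<otimes> h) \<beta> = \<beta>"
    if "g \<in> carrier G" "h \<in> carrier G" "\<beta> \<in> E" for g h \<beta>
  proof -
    have "\<phi> g \<beta> = \<phi> h \<beta> \<longleftrightarrow> \<phi> (inv g) (\<phi> g \<beta>) = \<phi> (inv g) (\<phi> h \<beta>)"
      using inj_prop[of "inv g"] that in_E by (auto dest: inj_onD)
    also have "\<phi> (inv g) (\<phi> g \<beta>) = \<beta>"
      using act[of "inv g" g \<beta>] that one_act by simp
    finally show ?thesis using that act by auto
  qed
  fix \<theta> assume th: "\<theta> \<in> two_closure E (\<phi> ` carrier G)"
  have th_bij: "\<theta> \<in> Bij E" using th unfolding two_closure_def by blast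
  have th2: "\<exists>g\<in>carrier G. \<theta> \<beta> = \<phi> g \<beta> \<and> \<theta> \<gamma> = \<phi> g \<gamma>" if "\<beta> \<in> E" "\<gamma> \<in> E" for \<beta> \<gamma>
    using th that unfolding two_closure_def by blast
  obtain g where g: "g \<in> carrier G"
    and g_th: "\<And>\<beta>. \<beta> \<in> E \<Longrightarrow> \<exists>i::int. \<theta> \<beta> = \<phi> (g \<otimes> c [^] i) \<beta>"
  proof (cases "\<forall>h\<in>carrier G. \<exists>i::int. h = c [^] i")
    case True
    have "\<exists>i::int. \<theta> \<beta> = \<phi> (\<one> \<otimes> c [^] i) \<beta>" if "\<beta> \<in> E" for \<beta>
      using th2[OF that that] True c by (metis G.l_one)
    then show ?thesis using that by blast
  next
    case False
    then obtain \<alpha> where \<alpha>: "\<alpha> \<in> E"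
      "\<And>h. h \<in> carrier G \<Longrightarrow> \<phi> h \<alpha> = \<alpha> \<Longrightarrow> \<exists>i::int. h = c [^] i"
      using stab by blast
    obtain g where g: "g \<in> carrier G" "\<theta> \<alpha> = \<phi> g \<alpha>" using th2[OF \<alpha>(1) \<alpha>(1)] by blast
    have "\<exists>i::int. \<theta> \<beta> = \<phi> (g \<otimes> c [^] i) \<beta>" if \<beta>: "\<beta> \<in> E" for \<beta>
    proof -
      obtain h where h: "h \<in> carrier G" "\<theta> \<alpha> = \<phi> h \<alpha>" "\<theta> \<beta> = \<phi> h \<beta>"
        using th2[OF \<alpha>(1) \<beta>] by blast
      have "\<phi> (inv g \<otimes> h) \<alpha> = \<alpha>"
        using cancel[OF g(1) h(1) \<alpha>(1)] g(2) h(2) by simp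
      then obtain i :: int where i: "inv g \<otimes> h = c [^] i"
        using \<alpha>(2) g(1) h(1) by blast
      then have "h = g \<otimes> c [^] i"
        using g(1) h(1) c by (metis G.int_pow_closed G.inv_solve_left')
      then show ?thesis using h(3) by blast
    qed
    then show ?thesis using that g(1) by blast
  qed
  \<comment> \<open>\<open>I \<beta>\<close> collects the exponents with which \<theta> can be
    imitated at the point \<beta>. It is a coset of the group of those exponents whose power of
    \<open>c\<close> fixes \<beta>.\<close>
  define I where "I \<beta> = {i::int. \<theta> \<beta> = \<phi> (g \<otimes> c [^] i) \<beta>}" for \<beta>
  have I_iff: "i \<in> I \<beta> \<longleftrightarrow> \<phi> (c [^] (i - j)) \<beta> = \<beta>" if "\<beta> \<in> E" "j \<in> I \<beta>" for i j \<beta>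
  proof -
    have "i \<in> I \<beta> \<longleftrightarrow> \<phi> (g \<otimes> c [^] j) \<beta> = \<phi> (g \<otimes> c [^] i) \<beta>"
      using that unfolding I_def by auto
    also have "\<dots> \<longleftrightarrow> \<phi> (inv (g \<otimes> c [^] j) \<otimes> (g \<otimes> c [^] i)) \<beta> = \<beta>"
      using cancel that g c by simp
    also have "inv (g \<otimes> c [^] j) \<otimes> (g \<otimes> c [^] i) = c [^] (- j) \<otimes> c [^] i"
      using g c by (simp add: G.inv_mult_cancel_left G.int_pow_neg)
    also have "\<dots> = c [^] (i - j)"
      using G.int_pow_mult[OF c, of "- j" i] by simp
    finally show ?thesis .
  qed
  have cpow_act: "\<phi> (c [^] (i + j)) \<beta> = \<beta>" if "\<beta> \<in> E" "\<phi> (c [^] i) \<beta> = \<beta>" "\<phi> (c [^] j) \<beta> = \<beta>"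
    for i j :: int and \<beta>
    using act[of "c [^] i" "c [^] j" \<beta>] that c by (simp add: G.int_pow_mult)
  have coset: "int_coset (I \<beta>)" if \<beta>: "\<beta> \<in> E" for \<beta>
  proof -
    obtain a where a: "a \<in> I \<beta>" using g_th[OF \<beta>] unfolding I_def by blast
    show ?thesis
    proof (rule int_cosetI[OF a])
      fix i j k assume ijk: "i \<in> I \<beta>" "j \<in> I \<beta>" "k \<in> I \<beta>"
      then show "i - j + k \<in> I \<beta>" using I_iff[OF \<beta>, of j i] I_iff[OF \<beta>, of k "i - j + k"] \<beta> by simp
    qed
  qed
  have meet: "I \<beta> \<inter> I \<gamma> \<noteq> {}" if \<beta>\<gamma>: "\<beta> \<in> E" "\<gamma> \<in> E" for \<beta> \<gamma>
  proof -
    obtain g' where g': "g' \<in> carrier G" "\<theta> \<beta> = \<phi> g' \<beta>" "\<theta> \<gamma> = \<phi> g' \<gamma>"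
      using th2[OF \<beta>\<gamma>] by blast
    define u where "u = inv g \<otimes> g'"
    have u: "u \<in> carrier G" "g' = g \<otimes> u"
      unfolding u_def using g g'(1) by (simp_all flip: G.m_assoc)
    obtain i :: int where i: "u [^] e = c [^] i" using pow_in[OF u(1)] by blast
    \<comment> \<open>The element \<open>v\<close> fixes \<delta>. Since \<open>c\<close> is central
      and \<open>c [^] e = c\<close>, its power \<open>v [^] e\<close> is
      \<open>c [^] (i - j)\<close>, which therefore fixes \<delta> as well. The exponent
      \<open>i\<close> depends only on \<open>u\<close>, so it serves both points.\<close>
    have "i \<in> I \<delta>" if \<delta>: "\<delta> \<in> E" "\<theta> \<delta> = \<phi> g' \<delta>" for \<delta>
    proof -
      obtain j where j: "j \<in> I \<delta>" using g_th[OF \<delta>(1)] unfolding I_def by blast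
      define v where "v = inv (c [^] j) \<otimes> u"
      have v: "v \<in> carrier G" unfolding v_def using c u by simp
      have "\<phi> (g \<otimes> c [^] j) \<delta> = \<phi> (g \<otimes> u) \<delta>"
        using j \<delta>(2) unfolding I_def u(2) by simp
      then have "\<phi> (inv (g \<otimes> c [^] j) \<otimes> (g \<otimes> u)) \<delta> = \<delta>"
        using cancel \<delta>(1) g c u by simp
      then have fixv: "\<phi> v \<delta> = \<delta>" unfolding v_def using g c u(1) by (simp add: G.inv_mult_cancel_left)
      have fixpow: "\<phi> (v [^] (k::nat)) \<delta> = \<delta>" for k
        by (induction k) (use act v \<delta>(1) fixv one_act in auto)
      have comm: "u \<otimes> inv (c [^] j) = inv (c [^] j) \<otimes> u"
        using G.int_pow_commute[OF central[OF u(1)] c u(1), of "- j"] c by (simp add: G.int_pow_neg)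
      have "v [^] e = inv (c [^] j) [^] e \<otimes> u [^] e"
        unfolding v_def using G.pow_mult_distrib[OF comm[symmetric]] c u(1) by simp
      also have "inv (c [^] j) [^] e = (c [^] int e) [^] (- j)"
        using c by (simp add: G.int_pow_pow mult.commute flip: int_pow_int G.int_pow_neg)
      also have "\<dots> = c [^] (- j)" using ce by (simp add: int_pow_int)
      also have "c [^] (- j) \<otimes> u [^] e = c [^] (i - j)"
        unfolding i using G.int_pow_mult[OF c, of "- j" i] by simp
      finally show "i \<in> I \<delta>" using fixpow[of e] I_iff[OF \<delta>(1) j] by simp
    qed
    then show ?thesis using g' \<beta>\<gamma> by blast
  qed
  have "\<Inter>(I ` E) \<noteq> {}"
  proof (rule int_cosets_Helly)
    let ?n = "int (G.ord c)"
    have n: "?n > 0" using G.ord_ge_1[OF fin c] by simp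
    have "I ` E \<subseteq> {S. \<forall>i. i \<in> S \<longleftrightarrow> i mod ?n \<in> S}"
    proof (clarify)
      fix \<beta> i
      have "c [^] i = c [^] (i mod ?n)"
        unfolding G.int_pow_eq[OF c] by (metis mod_eq_dvd_iff mod_mod_trivial)
      then show "i \<in> I \<beta> \<longleftrightarrow> i mod ?n \<in> I \<beta>" unfolding I_def by simp
    qed
    then show "finite (I ` E)" using finite_periodic_int_sets[OF n] finite_subset by blast
  qed (use coset meet in auto)
  then obtain i where i: "\<And>\<beta>. \<beta> \<in> E \<Longrightarrow> i \<in> I \<beta>" by blast
  have "\<theta> = \<phi> (g \<otimes> c [^] i)"
  proof (rule extensionalityI)
    show "\<theta> \<in> extensional E" using th_bij by (rule Bij_imp_extensional)
    show "\<phi> (g \<otimes> c [^] i) \<in> extensional E" using bij_prop0 g c by (intro Bij_imp_extensional) simp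
  qed (use i in \<open>auto simp: I_def\<close>)
  then show "\<theta> \<in> \<phi> ` carrier G" using g c by blast
qed

end


section \<open>From faithful actions to 2-closed groups\<close>

text \<open>A subgroup of the symmetric group isomorphic to \<open>G\<close> is the image of a
  faithful action of \<open>G\<close>, and the image of an action always lies in its 2-closure. Only
  the other inclusion has to be checked.\<close>

lemma two_closed_groupI:
  assumes "group G"
    and closed: "\<And>(E :: 'b set) \<phi>. group_action G E \<phi> \<Longrightarrow> inj_on \<phi> (carrier G) \<Longrightarrow>
      two_closure E (\<phi> ` carrier G) \<subseteq> \<phi> ` carrier G"
  shows "two_closed_group G TYPE('b)"
  unfolding two_closed_group_def
proof (intro allI impI)
  fix E :: "'b set" and H
  assume "subgroup H (BijGroup E) \<and> G \<cong> (BijGroup E)\<lparr>carrier := H\<rparr>"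
  then obtain \<phi> where H: "subgroup H (BijGroup E)" and \<phi>: "\<phi> \<in> iso G ((BijGroup E)\<lparr>carrier := H\<rparr>)"
    unfolding is_iso_def by blast
  have img: "\<phi> ` carrier G = H" "inj_on \<phi> (carrier G)"
    using \<phi> by (auto simp: iso_iff)
  have "\<phi> \<in> hom G (BijGroup E)"
    using \<phi> subgroup.subset[OF H] by (auto simp: iso_def hom_def)
  then have "group_action G E \<phi>"
    using assms(1) group_BijGroup by (simp add: group_action_def group_hom_def group_hom_axioms_def)
  then show "H = two_closure E H"
    using closed[OF _ img(2)] group_action.two_closure_superset[of G E \<phi>] img(1) by blast
qed

lemma two_closed_group_iso:
  assumes "group G" "G \<cong> G'" "two_closed_group G' TYPE('b)"
  shows "two_closed_group G TYPE('b)"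
  using assms group.iso_sym iso_trans unfolding two_closed_group_def by blast

lemma cyclic_imp_two_closed_group:
  assumes "group G" "finite (carrier G)" "cyclic_group G"
  shows "two_closed_group G TYPE('b)"
proof (rule two_closed_groupI[OF assms(1)])
  fix E :: "'b set" and \<phi>
  assume act: "group_action G E \<phi>"
  interpret G: group G by fact
  obtain c where c: "c \<in> carrier G" "carrier G = range (\<lambda>n::int. c [^]\<^bsub>G\<^esub> n)"
    using assms(3) unfolding G.cyclic_group by blast
  interpret comm_group G using G.cyclic_imp_abelian_group assms(3) by blast
  show "two_closure E (\<phi> ` carrier G) \<subseteq> \<phi> ` carrier G"
  proof (rule group_action.two_closure_cyclic_stabilizer[OF act assms(2) c(1), of 1])
    show "\<exists>i::int. h [^]\<^bsub>G\<^esub> (1::nat) = c [^]\<^bsub>G\<^esub> i" if "h \<in> carrier G" for h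
      using that c(2) by auto
  qed (use c m_comm in auto)
qed

section \<open>Generalized quaternion groups and their products with odd cyclic groups\<close>

lemma carrier_quaternion_group:
  "carrier (quaternion_group n) = {0..<2 ^ (n - 1)} \<times> {0..<2}"
  by (simp add: quaternion_group_def)

lemma quaternion_group_elemE:
  assumes "x \<in> carrier (quaternion_group n)"
  obtains i a where "x = (i, a)" "0 \<le> i" "i < 2 ^ (n - 1)" "a = 0 \<or> a = 1"
proof -
  obtain i a where x: "x = (i, a)" by (cases x)
  then have "0 \<le> i" "i < 2 ^ (n - 1)" "0 \<le> a" "a < 2"
    using assms by (simp_all add: carrier_quaternion_group)
  then show thesis using that[OF x] by (auto simp: le_less)
qed

lemma one_quaternion_group [simp]: "\<one>\<^bsub>quaternion_group n\<^esub> = (0, 0)"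
  by (simp add: quaternion_group_def)

lemma mult_quaternion_group:
  "(i, a) \<otimes>\<^bsub>quaternion_group n\<^esub> (j, b) =
     ((i + (if a = 1 then - j else j) + (if a = 1 \<and> b = 1 then 2 ^ (n - 2) else 0)) mod 2 ^ (n - 1),
      (a + b) mod 2)"
  by (simp add: quaternion_group_def)

lemma group_quaternion_group:
  assumes "n \<ge> 3"
  shows "group (quaternion_group n)"
proof -
  define h :: int where "h = 2 ^ (n - 2)"
  have M: "2 ^ (n - 1) = 2 * h"
    unfolding h_def using assms by (simp flip: power_Suc add: Suc_diff_Suc numeral_2_eq_2)
  have h: "h > 0" unfolding h_def by simp
  have mult: "(i, a) \<otimes>\<^bsub>quaternion_group n\<^esub> (j, b) =
     ((i + (if a = 1 then - j else j) + (if a = 1 \<and> b = 1 then h else 0)) mod (2 * h),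
      (a + b) mod 2)" for i a j b
    unfolding mult_quaternion_group M h_def ..
  have carrier: "carrier (quaternion_group n) = {0..<2 * h} \<times> {0..<2}"
    unfolding carrier_quaternion_group M ..
  have shift: "(h + r mod (2 * h) - s) mod (2 * h) = (h + r - s) mod (2 * h)" for r s
    by (metis mod_add_right_eq mod_diff_left_eq)
  show ?thesis
  proof (rule groupI)
    fix x y z
    assume "x \<in> carrier (quaternion_group n)" "y \<in> carrier (quaternion_group n)"
      "z \<in> carrier (quaternion_group n)"
    then obtain i a j b k c where xyz: "x = (i, a)" "y = (j, b)" "z = (k, c)"
      and abc: "a = 0 \<or> a = 1" "b = 0 \<or> b = 1" "c = 0 \<or> c = 1"
      by (metis quaternion_group_elemE)
    \<comment> \<open>This is associativity for \<open>a = b = c = 1\<close>, where it rests on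
      \<open>h\<close> and \<open>- h\<close> being congruent modulo \<open>2 * h\<close>.\<close>
    have "(i - j + h + k) mod (2 * h) = (i - (j - k + h)) mod (2 * h)"
      by (simp add: mod_eq_dvd_iff)
    then show "x \<otimes>\<^bsub>quaternion_group n\<^esub> y \<otimes>\<^bsub>quaternion_group n\<^esub> z =
      x \<otimes>\<^bsub>quaternion_group n\<^esub> (y \<otimes>\<^bsub>quaternion_group n\<^esub> z)"
      using abc unfolding xyz by (elim disjE) (simp_all add: mult mod_simps algebra_simps shift[simplified mult.commute[of 2]])
  next
    fix x assume x: "x \<in> carrier (quaternion_group n)"
    then obtain i a where ia: "x = (i, a)" "0 \<le> i" "i < 2 * h" "a = 0 \<or> a = 1"
      using quaternion_group_elemE unfolding M[symmetric] by metis
    \<comment> \<open>Every element outside the rotations squares to the rotation by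
      \<open>h\<close>, so its inverse is its product with that rotation.\<close>
    let ?y = "if a = 1 then ((i + h) mod (2 * h), 1) else (- i mod (2 * h), 0)"
    have "?y \<otimes>\<^bsub>quaternion_group n\<^esub> x = \<one>\<^bsub>quaternion_group n\<^esub>"
      using ia(4) shift[of "i + h" i] unfolding ia(1) by (auto simp: mult mod_simps algebra_simps)
    moreover have "?y \<in> carrier (quaternion_group n)" using h unfolding carrier by simp
    ultimately show "\<exists>y\<in>carrier (quaternion_group n).
        y \<otimes>\<^bsub>quaternion_group n\<^esub> x = \<one>\<^bsub>quaternion_group n\<^esub>" by blast
  qed (use h in \<open>auto simp: carrier mult\<close>)
qed

lemma pow_quaternion_group_rotation:
  assumes "0 \<le> i" "i < 2 ^ (n - 1)"
  shows "(i, 0) [^]\<^bsub>quaternion_group n\<^esub> (k::nat) = ((int k * i) mod 2 ^ (n - 1), 0)"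
  by (induction k) (simp_all add: mult_quaternion_group mod_simps algebra_simps)

lemma pow_DirProd:
  "(x, y) [^]\<^bsub>G \<times>\<times> H\<^esub> (k::nat) = (x [^]\<^bsub>G\<^esub> k, y [^]\<^bsub>H\<^esub> k)"
  by (induction k) simp_all

text \<open>Every nontrivial subgroup contains the unique involution. An element outside the
  rotations squares to it; the rotation by \<open>2 ^ f * u\<close> with \<open>u\<close> odd
  reaches it after raising to the power \<open>2 ^ (n - 2 - f)\<close>. A further odd factor
  \<open>m\<close> in the exponent does no harm, and it makes the same power trivial in a cyclic
  factor of order \<open>m\<close>.\<close>

lemma quaternion_group_power_eq_involution:
  fixes m :: nat
  assumes n: "n \<ge> 3" and "odd m"
    and x: "x \<in> carrier (quaternion_group n)" "x \<noteq> (0, 0)"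
  shows "\<exists>k. x [^]\<^bsub>quaternion_group n\<^esub> (m * k) = (2 ^ (n - 2), 0)"
proof -
  interpret Q: group "quaternion_group n" by (rule group_quaternion_group[OF n])
  define h :: int where "h = 2 ^ (n - 2)"
  have M: "2 ^ (n - 1) = 2 * h"
    unfolding h_def using n by (simp flip: power_Suc add: Suc_diff_Suc numeral_2_eq_2)
  have h: "h > 0" unfolding h_def by simp
  have odd_mult: "(t * h) mod (2 * h) = h" if "odd t" for t :: int
  proof -
    obtain r where "t = 2 * r + 1" using \<open>odd t\<close> by (elim oddE)
    then have "t * h = h + (2 * h) * r" by (simp add: algebra_simps)
    then show ?thesis using h by simp
  qed
  obtain i a where ia: "x = (i, a)" "0 \<le> i" "i < 2 * h" "a = 0 \<or> a = 1"
    using quaternion_group_elemE[OF x(1)] unfolding M by blast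
  have rot: "(j, 0) [^]\<^bsub>quaternion_group n\<^esub> (k::nat) = ((int k * j) mod (2 * h), 0)"
    if "0 \<le> j" "j < 2 * h" for j k
    using pow_quaternion_group_rotation[of j n k] that unfolding M by simp
  show ?thesis
  proof (cases "a = 1")
    case True
    have "x [^]\<^bsub>quaternion_group n\<^esub> (2::nat) = (h, 0)"
    proof -
      have "x [^]\<^bsub>quaternion_group n\<^esub> (2::nat) = x \<otimes>\<^bsub>quaternion_group n\<^esub> x"
        using Q.l_one[OF x(1)] by (simp add: numeral_2_eq_2)
      then show ?thesis
        using h True ia(1) by (simp add: mult_quaternion_group M[simplified] flip: h_def)
    qed
    then have "x [^]\<^bsub>quaternion_group n\<^esub> (2 * m) = (h, 0) [^]\<^bsub>quaternion_group n\<^esub> m"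
      using Q.nat_pow_pow[OF x(1), of 2 m] by simp
    also have "\<dots> = (h, 0)" using rot[of h m] h odd_mult[of "int m"] \<open>odd m\<close> by simp
    finally show ?thesis unfolding h_def by (metis mult.commute)
  next
    case False
    then have "i \<noteq> 0" "a = 0" using x(2) ia by auto
    obtain f u where fu: "i = 2 ^ f * u" "odd u"
      by (rule multiplicity_decompose'[of i 2]) (use \<open>i \<noteq> 0\<close> that in auto)
    have "(2::int) ^ f \<le> i"
      using fu ia(2) \<open>i \<noteq> 0\<close> by (intro zdvd_imp_le) auto
    then have "(2::int) ^ f < 2 ^ (n - 1)" using ia(3) M by simp
    then have "f < n - 1" by simp
    then have "f + (n - 2 - f) = n - 2" by simp
    then have "(2::int) ^ (n - 2 - f) * 2 ^ f = h"
      unfolding h_def by (metis power_add mult.commute)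
    then have "int (m * 2 ^ (n - 2 - f)) * i = (int m * u) * h"
      unfolding fu(1) by (simp add: algebra_simps)
    then have "(int (m * 2 ^ (n - 2 - f)) * i) mod (2 * h) = h"
      using odd_mult[of "int m * u"] \<open>odd m\<close> fu(2) by (metis even_mult_iff even_of_nat_iff)
    then have "x [^]\<^bsub>quaternion_group n\<^esub> (m * 2 ^ (n - 2 - f)) = (h, 0)"
      using rot[OF ia(2,3)] ia(1) \<open>a = 0\<close> by metis
    then show ?thesis unfolding h_def by blast
  qed
qed

lemma quaternion_cyclic_two_closed_group:
  assumes n: "n \<ge> 3" and "odd m"
  shows "two_closed_group (quaternion_group n \<times>\<times> integer_mod_group m) TYPE('b)"
proof -
  let ?Q = "quaternion_group n" and ?C = "integer_mod_group m"
  let ?D = "?Q \<times>\<times> ?C"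
  interpret Q: group ?Q by (rule group_quaternion_group[OF n])
  interpret D: group ?D by (intro DirProd_group group_quaternion_group n group_integer_mod_group)
  have m: "m > 0" using \<open>odd m\<close> by (cases m) auto
  have carrier_D: "carrier ?D = ({0..<2 ^ (n - 1)} \<times> {0..<2}) \<times> {0..<int m}"
    using m by (simp add: DirProd_def carrier_quaternion_group carrier_integer_mod_group)
  have fin: "finite (carrier ?D)" unfolding carrier_D by simp
  \<comment> \<open>The reduction covers \<open>m = 1\<close>, where the generator is 0.\<close>
  define c :: "(int \<times> int) \<times> int" where "c = ((0, 0), 1 mod int m)"
  have c: "c \<in> carrier ?D" using m unfolding carrier_D c_def by simp
  have c_pow: "c [^]\<^bsub>?D\<^esub> (k::nat) = ((0, 0), int k mod int m)" for k
    unfolding c_def pow_DirProd using Q.nat_pow_one[of k] by (simp add: mod_simps)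
  have c_int_pow: "\<exists>k::int. ((0, 0), l) = c [^]\<^bsub>?D\<^esub> k" if "0 \<le> l" "l < int m" for l
    using c_pow[of "nat l"] that by (intro exI[of _ l]) (metis int_pow_int mod_pos_pos_trivial nat_0_le)
  \<comment> \<open>The exponent \<open>e\<close> built from this identity is 0 modulo
    \<open>2 ^ n\<close> and 1 modulo \<open>m\<close>. Raising to it kills the quaternion factor,
    whose order is \<open>2 ^ n\<close>, and fixes the cyclic factor.\<close>
  obtain u v where uv: "u * 2 ^ n + v * int m = 1"
    using bezout_int[of "2 ^ n" "int m"] \<open>odd m\<close>
    by (metis coprime_imp_gcd_eq_1 coprime_power_left_iff coprime_left_2_iff_odd even_of_nat_iff)
  define t where "t = nat (u mod int m)"
  have t: "int t = u mod int m" unfolding t_def using m by simp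
  define e where "e = 2 ^ n * t"
  have e: "(int e * l) mod int m = l mod int m" for l
  proof -
    have "(int e * l) mod int m = (2 ^ n * u * l) mod int m"
      unfolding e_def by (simp add: t) (metis mod_mult_left_eq mod_mult_right_eq)
    also have "2 ^ n * u = 1 - v * int m" using uv by (simp add: algebra_simps)
    finally show ?thesis by (simp add: left_diff_distrib mult.assoc mult.left_commute flip: mod_diff_right_eq)
  qed
  have ord_Q: "x [^]\<^bsub>?Q\<^esub> ((2::nat) ^ n) = (0, 0)" if x: "x \<in> carrier ?Q" for x
  proof -
    have "order ?Q = 2 ^ (n - 1) * 2"
      unfolding order_def carrier_quaternion_group by (simp add: card_cartesian_product)
    also have "\<dots> = 2 ^ n" using n by (simp flip: power_Suc2)
    finally show ?thesis using Q.pow_order_eq_1[OF x] by simp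
  qed
  define z :: "(int \<times> int) \<times> int" where "z = ((2 ^ (n - 2), 0), 0)"
  have z: "z \<in> carrier ?D" "z \<noteq> \<one>\<^bsub>?D\<^esub>" using n m unfolding carrier_D z_def by auto
  show ?thesis
  proof (rule two_closed_groupI[OF D.group_axioms])
    fix E :: "'b set" and \<phi>
    assume act: "group_action ?D E \<phi>" and inj: "inj_on \<phi> (carrier ?D)"
    interpret group_action ?D E \<phi> by fact
    have "\<phi> z \<noteq> \<phi> \<one>\<^bsub>?D\<^esub>" using inj_on_eq_iff[OF inj z(1) D.one_closed] z(2) by blast
    then obtain \<alpha> where \<alpha>: "\<alpha> \<in> E" "\<phi> z \<alpha> \<noteq> \<alpha>"
      using id_eq_one bij_prop0[OF z(1)] unfolding Bij_def
      by (metis (no_types, lifting) IntD1 extensionalityI restrict_apply' restrict_extensional)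
    show "two_closure E (\<phi> ` carrier ?D) \<subseteq> \<phi> ` carrier ?D"
    proof (rule two_closure_cyclic_stabilizer[OF fin c, of e])
      fix h assume h: "h \<in> carrier ?D"
      then obtain x l where xl: "h = (x, l)" "x \<in> carrier ?Q" "0 \<le> l" "l < int m"
        unfolding carrier_D carrier_quaternion_group by (cases h) auto
      show "c \<otimes>\<^bsub>?D\<^esub> h = h \<otimes>\<^bsub>?D\<^esub> c"
        using Q.l_one[OF xl(2)] Q.r_one[OF xl(2)] unfolding c_def xl(1) by (simp add: add.commute)
      have "h [^]\<^bsub>?D\<^esub> e = ((0, 0), l)"
        using e[of l] Q.nat_pow_pow[OF xl(2), of "2 ^ n" t] ord_Q[OF xl(2)] Q.nat_pow_one[of t] xl(3,4)
        unfolding xl(1) pow_DirProd by (simp add: e_def)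
      then show "\<exists>i::int. h [^]\<^bsub>?D\<^esub> e = c [^]\<^bsub>?D\<^esub> i"
        using c_int_pow[OF xl(3,4)] by simp
    next
      show "c [^]\<^bsub>?D\<^esub> e = c" unfolding c_pow using e[of 1] by (simp add: c_def)
    next
      have "\<exists>i::int. h = c [^]\<^bsub>?D\<^esub> i" if h: "h \<in> carrier ?D" "\<phi> h \<alpha> = \<alpha>" for h
      proof -
        obtain x l where xl: "h = (x, l)" "x \<in> carrier ?Q" "0 \<le> l" "l < int m"
          using h(1) unfolding carrier_D carrier_quaternion_group by (cases h) auto
        have "x = (0, 0)"
        proof (rule ccontr)
          \<comment> \<open>Some power of \<open>h\<close> with exponent divisible by
            \<open>m\<close> is then the involution \<open>z\<close>, which would have to fix
            \<alpha> together with \<open>h\<close>.\<close>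
          assume "x \<noteq> (0, 0)"
          then obtain k where "x [^]\<^bsub>?Q\<^esub> (m * k) = (2 ^ (n - 2), 0)"
            using quaternion_group_power_eq_involution[OF n \<open>odd m\<close> xl(2)] by blast
          then have "h [^]\<^bsub>?D\<^esub> (m * k) = z"
            unfolding xl(1) pow_DirProd z_def by simp
          moreover have "\<phi> (h [^]\<^bsub>?D\<^esub> (j::nat)) \<alpha> = \<alpha>" for j
          proof (induction j)
            case 0
            then show ?case using id_eq_one \<alpha>(1) by (metis D.nat_pow_0 restrict_apply')
          next
            case (Suc j)
            then show ?case using composition_rule[OF \<alpha>(1) D.nat_pow_closed[OF h(1), of j] h(1)] h(2)
              by simp
          qed
          ultimately show False using \<alpha>(2) by metis
        qed
        then show ?thesis using c_int_pow[OF xl(3,4)] xl(1) by simp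
      qed
      then show "(\<forall>h\<in>carrier ?D. \<exists>i::int. h = c [^]\<^bsub>?D\<^esub> i) \<or>
        (\<exists>\<alpha>\<in>E. \<forall>h\<in>carrier ?D. \<phi> h \<alpha> = \<alpha> \<longrightarrow> (\<exists>i::int. h = c [^]\<^bsub>?D\<^esub> i))"
        using \<alpha>(1) by blast
    qed
  qed
qed


section \<open>Representations that are not 2-closed\<close>

no_notation Multiset.subset_mset (infix \<open><#\<close> 50)

section \<open>Transport of finite actions to a given infinite type\<close>

lemma Bij_conjugate:
  assumes f: "inj_on f E" and s: "s \<in> Bij E"
  shows "restrict (\<lambda>y. f (s (inv_into E f y))) (f ` E) \<in> Bij (f ` E)"
proof -
  have fX: "bij_betw f E (f ` E)" using f by (rule inj_on_imp_bij_betw)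
  have "bij_betw (f o (s o inv_into E f)) (f ` E) (f ` E)"
    using s unfolding Bij_def
    by (intro bij_betw_trans[OF bij_betw_trans[OF bij_betw_inv_into[OF fX]] fX]) auto
  then have "bij_betw (\<lambda>y. f (s (inv_into E f y))) (f ` E) (f ` E)" by (simp add: comp_def)
  then show ?thesis unfolding Bij_def by (simp add: bij_betw_restrict_eq)
qed

text \<open>The property \<open>two_closed_group\<close> speaks of one fixed type of points, while
  the counterexamples act on sets of cosets. An infinite type contains a copy \<open>B\<close> of
  the finite set \<open>E\<close>, and conjugation \<open>\<tau>\<close> by the bijection carries
  the action and \<theta> over.\<close>

lemma not_two_closed_groupI:
  fixes E :: "'x set"
  assumes act: "group_action G E \<phi>" and inj: "inj_on \<phi> (carrier G)"
    and E: "finite E" and inf: "infinite (UNIV :: 'b set)"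
    and \<theta>: "\<theta> \<in> two_closure E (\<phi> ` carrier G)" "\<theta> \<notin> \<phi> ` carrier G"
  shows "\<not> two_closed_group G TYPE('b)"
proof
  interpret group_action G E \<phi> by fact
  interpret G: group G using group_hom group_hom.axioms(1) by blast
  assume closed: "two_closed_group G TYPE('b)"
  obtain B :: "'b set" where "finite B" "card B = card E"
    using infinite_arbitrarily_large[OF inf] by blast
  then obtain f where f: "bij_betw f E B"
    using E finite_same_card_bij by metis
  have f_inj: "inj_on f E" and f_img: "f ` E = B" using f by (auto simp: bij_betw_def)
  define \<tau> where "\<tau> s = restrict (\<lambda>y. f (s (inv_into E f y))) B" for s
  have \<tau>_f: "\<tau> s (f x) = f (s x)" if "x \<in> E" for s x
    unfolding \<tau>_def using that f_inj f_img by auto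
  have \<tau>_Bij: "\<tau> s \<in> Bij B" if "s \<in> Bij E" for s
    using Bij_conjugate[OF f_inj that] unfolding \<tau>_def f_img .
  have Bij_in: "s x \<in> E" if "s \<in> Bij E" "x \<in> E" for s x
    using that Bij_imp_funcset by blast
  have \<tau>_inj: "s = t" if "s \<in> Bij E" "t \<in> Bij E" "\<tau> s = \<tau> t" for s t
  proof (rule extensionalityI)
    fix x assume x: "x \<in> E"
    then have "f (s x) = f (t x)" using \<tau>_f that(3) by metis
    then show "s x = t x" using f_inj Bij_in that x by (auto dest: inj_onD)
  qed (use that in \<open>auto intro: Bij_imp_extensional\<close>)
  have B_eqI: "s = t" if "s \<in> Bij B" "t \<in> Bij B" "\<And>x. x \<in> E \<Longrightarrow> s (f x) = t (f x)" for s t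
    using that f_img by (intro extensionalityI[of s B t]) (auto intro: Bij_imp_extensional)
  have hom: "\<tau> o \<phi> \<in> hom G (BijGroup B)"
  proof (rule homI)
    show "(\<tau> o \<phi>) g \<in> carrier (BijGroup B)" if "g \<in> carrier G" for g
      using \<tau>_Bij bij_prop0 that by (simp add: BijGroup_def)
    fix g h assume gh: "g \<in> carrier G" "h \<in> carrier G"
    have Bij: "\<tau> (\<phi> g) \<in> Bij B" "\<tau> (\<phi> h) \<in> Bij B" "\<tau> (\<phi> (g \<otimes>\<^bsub>G\<^esub> h)) \<in> Bij B"
      using \<tau>_Bij bij_prop0 gh by simp_all
    have "\<tau> (\<phi> (g \<otimes>\<^bsub>G\<^esub> h)) = compose B (\<tau> (\<phi> g)) (\<tau> (\<phi> h))"
    proof (rule B_eqI)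
      fix x assume x: "x \<in> E"
      then have "f x \<in> B" using f_img by blast
      then show "\<tau> (\<phi> (g \<otimes>\<^bsub>G\<^esub> h)) (f x) = compose B (\<tau> (\<phi> g)) (\<tau> (\<phi> h)) (f x)"
        using x gh \<tau>_f element_image[OF _ _ refl] composition_rule by (simp add: compose_eq)
    qed (use Bij compose_Bij in auto)
    then show "(\<tau> o \<phi>) (g \<otimes>\<^bsub>G\<^esub> h) = (\<tau> o \<phi>) g \<otimes>\<^bsub>BijGroup B\<^esub> (\<tau> o \<phi>) h"
      using Bij by (simp add: BijGroup_def)
  qed
  define H where "H = (\<tau> o \<phi>) ` carrier G"
  have "group_hom G (BijGroup B) (\<tau> o \<phi>)"
    using hom group_BijGroup G.group_axioms by (simp add: group_hom_def group_hom_axioms_def)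
  then have "subgroup H (BijGroup B)"
    unfolding H_def by (rule group_hom.img_is_subgroup)
  moreover have "\<tau> o \<phi> \<in> iso G ((BijGroup B)\<lparr>carrier := H\<rparr>)"
  proof -
    have "inj_on (\<tau> o \<phi>) (carrier G)"
      using \<tau>_inj[OF bij_prop0 bij_prop0] inj unfolding inj_on_def comp_def by blast
    then show ?thesis using hom unfolding iso_def hom_def bij_betw_def H_def by auto
  qed
  ultimately have eq: "H = two_closure B H"
    using closed unfolding two_closed_group_def is_iso_def by blast
  have \<theta>_Bij: "\<theta> \<in> Bij E" using \<theta>(1) unfolding two_closure_def by blast
  have "\<exists>g\<in>H. \<tau> \<theta> (f x) = g (f x) \<and> \<tau> \<theta> (f y) = g (f y)" if xy: "x \<in> E" "y \<in> E" for x y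
  proof -
    obtain g where "g \<in> carrier G" "\<theta> x = \<phi> g x" "\<theta> y = \<phi> g y"
      using \<theta>(1) xy unfolding two_closure_def by blast
    then show ?thesis unfolding H_def using xy \<tau>_f by auto
  qed
  then have "\<tau> \<theta> \<in> two_closure B H"
    unfolding two_closure_def using \<tau>_Bij[OF \<theta>_Bij] f_img by blast
  then obtain g where "g \<in> carrier G" "\<tau> \<theta> = \<tau> (\<phi> g)" unfolding eq[symmetric] unfolding H_def by auto
  then show False using \<tau>_inj[OF \<theta>_Bij bij_prop0] \<theta>(2) by blast
qed

section \<open>Actions on left cosets\<close>

context group
begin

text \<open>A point is a coset together with a tag that the action preserves. Cosets with different
  tags stay different points even if they are equal as sets, so that a permutation may treat them
  differently.\<close>

lemma group_action_lcosets:
  assumes E: "\<And>p. p \<in> E \<Longrightarrow> snd p \<subseteq> carrier G"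
    and closed: "\<And>b S g. (b, S) \<in> E \<Longrightarrow> g \<in> carrier G \<Longrightarrow> (b, g <# S) \<in> E"
  shows "group_action G E (\<lambda>g. \<lambda>p\<in>E. (fst p, g <# snd p))"
proof -
  let ?\<phi> = "\<lambda>g. \<lambda>p\<in>E. (fst p, g <# snd p)"
  have mem: "?\<phi> g p \<in> E" if "g \<in> carrier G" "p \<in> E" for g p
    using closed[of "fst p" "snd p" g] that by simp
  have mult: "?\<phi> (g \<otimes> h) p = ?\<phi> g (?\<phi> h p)" if "g \<in> carrier G" "h \<in> carrier G" "p \<in> E" for g h p
    using that mem[OF that(2,3)] lcos_m_assoc[OF E[OF that(3)] that(1,2)] by simp
  have one: "?\<phi> \<one> p = p" if "p \<in> E" for p
    using that lcos_mult_one[OF E[OF that]] by simp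
  have Bij: "?\<phi> g \<in> Bij E" if g: "g \<in> carrier G" for g
  proof -
    have "bij_betw (?\<phi> g) E E"
    proof (rule bij_betwI[where g = "?\<phi> (inv g)"])
      show "?\<phi> (inv g) (?\<phi> g p) = p" if "p \<in> E" for p
        by (rule trans[OF mult[OF inv_closed[OF g] g that, symmetric, unfolded l_inv[OF g]] one[OF that]])
      show "?\<phi> g (?\<phi> (inv g) p) = p" if "p \<in> E" for p
        by (rule trans[OF mult[OF g inv_closed[OF g] that, symmetric, unfolded r_inv[OF g]] one[OF that]])
    qed (use g mem in auto)
    then show ?thesis unfolding Bij_def by simp
  qed
  have "?\<phi> (g \<otimes> h) = compose E (?\<phi> g) (?\<phi> h)" if "g \<in> carrier G" "h \<in> carrier G" for g h
    using mult[OF that] by (intro extensionalityI[of _ E]) (simp_all add: compose_eq del: restrict_apply)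
  then have "?\<phi> \<in> hom G (BijGroup E)"
    using Bij by (intro homI) (simp_all add: BijGroup_def)
  then show ?thesis
    using group_BijGroup group_axioms by (simp add: group_action_def group_hom_def group_hom_axioms_def)
qed

text \<open>The non-closed representation: on the cosets of \<open>N\<close> let \<open>\<theta>\<close> act as \<open>t\<close>, on the
  cosets of the members of \<open>F\<close> as the identity. Each stabilizer in the second part
  contains an element that acts as \<open>t\<close> on the first part, so pairs cannot tell \<open>\<theta>\<close> from \<open>G\<close>.\<close>

lemma not_two_closed_group_normal:
  assumes fin: "finite (carrier G)" and inf: "infinite (UNIV :: 'x set)"
    and N: "N \<lhd> G" and t: "t \<in> carrier G" "t \<notin> N"
    and F: "\<And>K. K \<in> F \<Longrightarrow> subgroup K G"
    and faithful: "\<And>g. g \<in> carrier G \<Longrightarrow>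
      (\<And>K x. K \<in> F \<Longrightarrow> x \<in> carrier G \<Longrightarrow> inv x \<otimes> g \<otimes> x \<in> K) \<Longrightarrow> g = \<one>"
    and lift: "\<And>K x. K \<in> F \<Longrightarrow> x \<in> carrier G \<Longrightarrow> \<exists>h\<in>K. x \<otimes> h \<otimes> inv x \<otimes> inv t \<in> N"
  shows "\<not> two_closed_group G TYPE('x)"
proof -
  have N_sub: "subgroup N G" using N by (rule normal_imp_subgroup)
  define E where "E = {(True, x <# N) | x. x \<in> carrier G} \<union>
    {(False, x <# K) | x K. x \<in> carrier G \<and> K \<in> F}"
  have sub: "S \<subseteq> carrier G" if S: "(b, S) \<in> E" for b S
  proof -
    obtain x K where "x \<in> carrier G" "subgroup K G" "S = x <# K"
      using S F N_sub unfolding E_def by blast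
    then show ?thesis using l_coset_subset_G[OF subgroup.subset] by simp
  qed
  have mult: "g <# (x <# K) = (g \<otimes> x) <# K" if "subgroup K G" "g \<in> carrier G" "x \<in> carrier G" for g x K
    using that lcos_m_assoc subgroup.subset by metis
  have closed: "(b, g <# S) \<in> E" if "(b, S) \<in> E" "g \<in> carrier G" for b S g
  proof -
    from that(1) consider (N) x where "b" "x \<in> carrier G" "S = x <# N"
      | (F) x K where "\<not> b" "x \<in> carrier G" "K \<in> F" "S = x <# K"
      unfolding E_def by blast
    then show ?thesis
    proof cases
      case N
      then have "g <# S = (g \<otimes> x) <# N" using mult[OF N_sub that(2)] by simp
      then show ?thesis using N that(2) unfolding E_def by blast
    next
      case (F x K)
      then have "g <# S = (g \<otimes> x) <# K" using mult[OF assms(6) that(2)] by simp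
      then show ?thesis using F that(2) unfolding E_def by blast
    qed
  qed
  have E_fin: "finite E"
  proof (rule finite_subset)
    show "E \<subseteq> UNIV \<times> Pow (carrier G)" using sub by (auto dest!: sub)
  qed (use fin in simp)
  let ?\<phi> = "\<lambda>g. \<lambda>p\<in>E. (fst p, g <# snd p)"
  have act: "group_action G E ?\<phi>"
  proof (rule group_action_lcosets)
    show "snd p \<subseteq> carrier G" if "p \<in> E" for p
      using sub[of "fst p" "snd p"] that by simp
  qed (rule closed)
  interpret group_action G E ?\<phi> by fact
  have fixes_iff: "g <# (x <# K) = h <# (x <# K) \<longleftrightarrow> inv x \<otimes> (inv g \<otimes> h) \<otimes> x \<in> K"
    if K: "subgroup K G" and gx: "g \<in> carrier G" "h \<in> carrier G" "x \<in> carrier G" for g h x K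
  proof -
    have "(g \<otimes> x) <# K = (h \<otimes> x) <# K \<longleftrightarrow> h \<otimes> x \<in> (g \<otimes> x) <# K"
      using K gx by (metis l_repr_independence lcos_self m_closed)
    also have "\<dots> \<longleftrightarrow> inv (g \<otimes> x) \<otimes> (h \<otimes> x) \<in> K"
    proof
      assume "h \<otimes> x \<in> (g \<otimes> x) <# K"
      then obtain k where "k \<in> K" "h \<otimes> x = g \<otimes> x \<otimes> k" unfolding l_coset_def by blast
      then show "inv (g \<otimes> x) \<otimes> (h \<otimes> x) \<in> K"
        using gx K by (metis inv_solve_left' m_closed subgroup.mem_carrier)
    next
      assume "inv (g \<otimes> x) \<otimes> (h \<otimes> x) \<in> K"
      moreover have "h \<otimes> x = g \<otimes> x \<otimes> (inv (g \<otimes> x) \<otimes> (h \<otimes> x))"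
        using gx by (simp flip: m_assoc)
      ultimately show "h \<otimes> x \<in> (g \<otimes> x) <# K" unfolding l_coset_def by blast
    qed
    finally show ?thesis using gx mult[OF K] by (simp add: inv_mult_group m_assoc)
  qed
  have eqD: "inv x \<otimes> (inv g \<otimes> h) \<otimes> x \<in> K"
    if "g \<in> carrier G" "h \<in> carrier G" "x \<in> carrier G" "K \<in> F"
      "?\<phi> g (False, x <# K) = ?\<phi> h (False, x <# K)" for g h x K
  proof -
    have "(False, x <# K) \<in> E" using that unfolding E_def by blast
    then show ?thesis using that fixes_iff[OF F] by simp
  qed
  have inj: "inj_on ?\<phi> (carrier G)"
  proof (rule inj_onI)
    fix g h assume gh: "g \<in> carrier G" "h \<in> carrier G" "?\<phi> g = ?\<phi> h"
    have "inv g \<otimes> h = \<one>"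
      by (rule faithful) (use gh eqD[OF gh(1,2)] in auto)
    then show "g = h" using gh(1,2) by (metis inv_closed inv_inv inv_equality)
  qed
  define \<theta> where "\<theta> = (\<lambda>p\<in>E. if fst p then ?\<phi> t p else ?\<phi> \<one> p)"
  have \<theta>_True: "\<theta> (True, S) = ?\<phi> t (True, S)" if "(True, S) \<in> E" for S
    using that unfolding \<theta>_def by simp
  have \<theta>_False: "\<theta> (False, S) = ?\<phi> \<one> (False, S)" if "(False, S) \<in> E" for S
    using that unfolding \<theta>_def by simp
  have pairs: "\<exists>g\<in>carrier G. \<theta> p = ?\<phi> g p \<and> \<theta> q = ?\<phi> g q"
    if p: "p \<in> E" and q: "q \<in> E" for p q
  proof -
    have mixed: "\<exists>g\<in>carrier G. \<theta> (True, S) = ?\<phi> g (True, S) \<and> \<theta> (False, T) = ?\<phi> g (False, T)"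
      if ST: "(True, S) \<in> E" "(False, T) \<in> E" for S T
    proof -
      obtain y where y: "y \<in> carrier G" "S = y <# N" using ST(1) unfolding E_def by blast
      obtain x K where xK: "x \<in> carrier G" "K \<in> F" "T = x <# K" using ST(2) unfolding E_def by blast
      obtain h where h: "h \<in> K" "x \<otimes> h \<otimes> inv x \<otimes> inv t \<in> N" using lift[OF xK(2,1)] by blast
      have hc: "h \<in> carrier G" using subgroup.mem_carrier[OF F[OF xK(2)] h(1)] .
      \<comment> \<open>This conjugate of \<open>h\<close> fixes the coset \<open>T\<close> and
        agrees with \<open>t\<close> modulo the normal subgroup \<open>N\<close>, hence acts as
        \<open>t\<close> on every coset of \<open>N\<close>.\<close>
      define g where "g = x \<otimes> h \<otimes> inv x"
      have g: "g \<in> carrier G" unfolding g_def using xK(1) hc by simp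
      have "inv x \<otimes> (inv \<one> \<otimes> g) \<otimes> x = (inv x \<otimes> x) \<otimes> h \<otimes> (inv x \<otimes> x)"
        unfolding g_def using xK(1) hc by (simp only: m_assoc inv_one l_one m_closed inv_closed one_closed)
      then have "inv x \<otimes> (inv \<one> \<otimes> g) \<otimes> x \<in> K"
        using xK(1) hc h(1) by simp
      then have gT: "\<one> <# T = g <# T"
        using fixes_iff[OF F[OF xK(2)], of \<one> g x] g xK by simp
      let ?n = "g \<otimes> inv t"
      have n: "?n \<in> N" using h(2) unfolding g_def .
      have "inv y \<otimes> (inv t \<otimes> g) \<otimes> y = (inv y \<otimes> inv t) \<otimes> ?n \<otimes> inv (inv y \<otimes> inv t)"
      proof -
        have "inv t \<otimes> (t \<otimes> y) = y" using y(1) t(1) by (simp flip: m_assoc)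
        then show ?thesis using y(1) t(1) g by (simp add: inv_mult_group m_assoc)
      qed
      also have "\<dots> \<in> N"
        using normal.inv_op_closed2[OF N _ n] y(1) t(1) by simp
      finally have "t <# S = g <# S"
        using fixes_iff[OF N_sub, of t g y] g y t(1) by simp
      then show ?thesis
        using ST gT g \<theta>_True[OF ST(1)] \<theta>_False[OF ST(2)] by auto
    qed
    obtain b S c T where pq: "p = (b, S)" "q = (c, T)" by (cases p, cases q)
    show ?thesis
    proof (cases b; cases c)
      assume "b" "c"
      then show ?thesis using p q pq t(1)
        by (intro bexI[of _ t]) (simp_all add: \<theta>_True del: restrict_apply)
    next
      assume "\<not> b" "\<not> c"
      then show ?thesis using p q pq
        by (intro bexI[of _ \<one>]) (simp_all add: \<theta>_False del: restrict_apply)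
    next
      assume "b" "\<not> c"
      then show ?thesis using p q pq mixed[of S T] by (simp del: restrict_apply)
    next
      assume "\<not> b" "c"
      then show ?thesis using p q pq mixed[of T S] by (auto simp del: restrict_apply)
    qed
  qed
  \<comment> \<open>On any two points \<theta> agrees with one group element, which acts
    injectively. So \<theta> is injective, and bijective because \<open>E\<close> is finite.\<close>
  have "\<theta> \<in> Bij E"
  proof -
    have mem: "\<theta> p \<in> E" if "p \<in> E" for p using pairs[OF that that] element_image that by metis
    have "inj_on \<theta> E"
    proof (rule inj_onI)
      fix p q assume pq: "p \<in> E" "q \<in> E" "\<theta> p = \<theta> q"
      obtain g where "g \<in> carrier G" "\<theta> p = ?\<phi> g p" "\<theta> q = ?\<phi> g q"
        using pairs[OF pq(1,2)] by blast
      then show "p = q" using inj_prop pq by (metis (no_types, lifting) inj_onD)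
    qed
    then have "bij_betw \<theta> E E"
      using E_fin mem by (metis bij_betw_def endo_inj_surj image_subsetI)
    then show ?thesis unfolding Bij_def \<theta>_def by simp
  qed
  then have "\<theta> \<in> two_closure E (?\<phi> ` carrier G)"
    unfolding two_closure_def using pairs by blast
  moreover have "\<theta> \<notin> ?\<phi> ` carrier G"
  proof
    assume "\<theta> \<in> ?\<phi> ` carrier G"
    then obtain g where g: "g \<in> carrier G" "\<theta> = ?\<phi> g" by blast
    \<comment> \<open>If \<open>g\<close> induced \<theta>, it would fix all cosets of members of
      \<open>F\<close> and be trivial by faithfulness, but \<theta> moves the point \<open>N\<close>
      because \<open>t\<close> is not in \<open>N\<close>.\<close>
    have "inv \<one> \<otimes> g = \<one>"
    proof (rule faithful)
      fix K x assume Kx: "K \<in> F" "x \<in> carrier G"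
      then have "(False, x <# K) \<in> E" unfolding E_def by blast
      then have "?\<phi> \<one> (False, x <# K) = ?\<phi> g (False, x <# K)"
        using \<theta>_False g(2) by metis
      then show "inv x \<otimes> (inv \<one> \<otimes> g) \<otimes> x \<in> K" by (rule eqD[OF one_closed g(1) Kx(2,1)])
    qed (use g in simp)
    then have "g = \<one>" using g(1) by simp
    have mem: "(True, \<one> <# N) \<in> E" unfolding E_def by blast
    then have "?\<phi> t (True, \<one> <# N) = ?\<phi> \<one> (True, \<one> <# N)"
      using \<theta>_True[OF mem] g(2) \<open>g = \<one>\<close> by (simp del: restrict_apply)
    then have "t <# (\<one> <# N) = \<one> <# (\<one> <# N)" using mem by simp
    then have "inv t \<in> N" using fixes_iff[OF N_sub, of t \<one> \<one>] t(1) by simp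
    then show False using t N_sub by (metis inv_inv subgroup.m_inv_closed)
  qed
  ultimately show ?thesis
    using not_two_closed_groupI[OF act inj E_fin inf] by blast
qed

end


section \<open>Elements of prime order in nilpotent and 2-closed groups\<close>

context group
begin

lemma mem_generate_singleton_iff:
  "a \<in> carrier G \<Longrightarrow> b \<in> generate G {a} \<longleftrightarrow> (\<exists>i::int. b = a [^] i)"
  unfolding generate_pow by auto

lemma subgroup_generate_singleton: "a \<in> carrier G \<Longrightarrow> subgroup (generate G {a}) G"
  by (simp add: generate_is_subgroup)

lemma conj_mult:
  assumes "x \<in> carrier G" "g \<in> carrier G" "h \<in> carrier G"
  shows "x \<otimes> (g \<otimes> h) \<otimes> inv x = x \<otimes> g \<otimes> inv x \<otimes> (x \<otimes> h \<otimes> inv x)"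
proof -
  have "inv x \<otimes> (x \<otimes> (h \<otimes> inv x)) = h \<otimes> inv x"
    using assms by (simp flip: m_assoc)
  then show ?thesis using assms by (simp add: m_assoc)
qed

lemma conj_int_pow:
  assumes "x \<in> carrier G" "g \<in> carrier G"
  shows "x \<otimes> g [^] (i::int) \<otimes> inv x = (x \<otimes> g \<otimes> inv x) [^] i"
proof -
  have "(\<lambda>g. x \<otimes> g \<otimes> inv x) \<in> hom G G"
    by (rule homI) (use assms conj_mult in simp_all)
  then show ?thesis using hom_int_pow[OF _ assms(2) group_axioms group_axioms] by fast
qed

lemma commute_iff_commutator:
  assumes "g \<in> carrier G" "x \<in> carrier G"
  shows "g \<otimes> x = x \<otimes> g \<longleftrightarrow> g \<otimes> x \<otimes> inv g \<otimes> inv x = \<one>"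
proof -
  have "g \<otimes> x \<otimes> inv g \<otimes> inv x = g \<otimes> x \<otimes> inv (x \<otimes> g)"
    using assms by (simp add: inv_mult_group m_assoc)
  then show ?thesis using assms
    by (metis inv_closed inv_inv inv_equality m_closed r_inv)
qed

lemma normal_lower_central: "lower_central G i \<lhd> G"
proof (induction i)
  case 0
  show ?case using normal_invI[OF subgroup_self] by simp
next
  case (Suc i)
  then interpret N: normal "lower_central G i" G .
  show ?case unfolding lower_central.simps
  proof (rule normal_generateI)
    fix c g
    assume c: "c \<in> (\<Union>x\<in>carrier G. \<Union>h\<in>lower_central G i. {x \<otimes> h \<otimes> inv x \<otimes> inv h})"
      and g: "g \<in> carrier G"
    then obtain x h where xh: "x \<in> carrier G" "h \<in> lower_central G i" "c = x \<otimes> h \<otimes> inv x \<otimes> inv h"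
      by blast
    let ?c = "\<lambda>y. g \<otimes> y \<otimes> inv g"
    note mult = conj_mult[OF g]
    have inv: "?c (inv y) = inv (?c y)" if "y \<in> carrier G" for y
      using that g by (simp add: inv_mult_group m_assoc)
    have h: "h \<in> carrier G" using xh(2) N.mem_carrier by blast
    have "?c c = ?c x \<otimes> ?c h \<otimes> inv (?c x) \<otimes> inv (?c h)"
      unfolding xh(3) using mult inv xh(1) h g by simp
    moreover have "?c x \<in> carrier G" "?c h \<in> lower_central G i"
      using xh g N.inv_op_closed2 by simp_all
    ultimately show "?c c \<in> (\<Union>x\<in>carrier G. \<Union>h\<in>lower_central G i. {x \<otimes> h \<otimes> inv x \<otimes> inv h})"
      by blast
  qed (use N.mem_carrier in auto)
qed

lemma commutator_in_lower_central:
  assumes "x \<in> carrier G" "h \<in> lower_central G i"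
  shows "x \<otimes> h \<otimes> inv x \<otimes> inv h \<in> lower_central G (Suc i)"
  using assms by (auto intro!: generate.incl)

text \<open>Take the first term of the series that misses \<open>A\<close>; it is not term 0, so it
  has a predecessor. The point is that all commutators with \<open>x\<close> then lie outside
  \<open>A\<close>.\<close>

lemma nilpotent_deepest_element:
  assumes nil: "nilpotent_group G" and "A \<subseteq> carrier G" "A \<noteq> {}" "\<one> \<notin> A"
  obtains i x where "x \<in> A" "x \<in> lower_central G i" "A \<inter> lower_central G (Suc i) = {}"
proof -
  obtain k where "lower_central G k = {\<one>}" using nil unfolding nilpotent_group_def by blast
  then have k: "A \<inter> lower_central G k = {}" using \<open>\<one> \<notin> A\<close> by auto
  define j where "j = (LEAST j. A \<inter> lower_central G j = {})"
  have j: "A \<inter> lower_central G j = {}" unfolding j_def using k by (rule LeastI)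
  moreover have "A \<inter> lower_central G 0 \<noteq> {}" using assms(2,3) by auto
  ultimately obtain i where i: "j = Suc i" by (metis not0_implies_Suc)
  have "A \<inter> lower_central G i \<noteq> {}"
    using not_less_Least[of i "\<lambda>j. A \<inter> lower_central G j = {}"] i unfolding j_def by auto
  then show thesis using that j i by blast
qed

lemma ord_eq_prime:
  assumes "Factorial_Ring.prime p" "a \<in> carrier G" "a [^] (p::nat) = \<one>" "a \<noteq> \<one>"
  shows "ord a = p"
  using assms pow_eq_id[of a p] ord_eq_1[of a] by (metis One_nat_def prime_nat_iff)

lemma prime_order_power_generates:
  assumes p: "Factorial_Ring.prime p" and a: "a \<in> carrier G" "a [^] (p::nat) = \<one>"
    and i: "a [^] (i::int) \<noteq> \<one>"
  shows "\<exists>j::int. a = (a [^] i) [^] j"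
proof -
  have "a \<noteq> \<one>" using i by auto
  then have ord: "ord a = p" using ord_eq_prime p a by blast
  have "\<not> int p dvd i" using i int_pow_eq_id[OF a(1)] ord by simp
  then have "coprime i (int p)" using p
    by (metis coprime_commute prime_imp_coprime prime_nat_int_transfer)
  then obtain u v where uv: "u * i + v * int p = 1" by (metis bezout_int coprime_imp_gcd_eq_1)
  then have "i * u - 1 = int p * (- v)" by (simp add: algebra_simps)
  then have "int p dvd i * u - 1" by (metis dvd_triv_left)
  then have "a [^] (1::int) = a [^] (i * u)" using int_pow_eq[OF a(1), of 1 "i * u"] ord by simp
  then show ?thesis using a(1) by (auto simp: int_pow_pow)
qed

text \<open>Let \<open>i\<close> be the last index with \<open>a\<close> in the \<open>i\<close>-th
  term. A commutator of \<open>g\<close> and \<open>a\<close> lies both in the subgroup of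
  \<open>a\<close> and in the next term. If nontrivial, it would generate \<open>a\<close> because
  \<open>p\<close> is prime, and \<open>a\<close> would lie in the next term too.\<close>

lemma nilpotent_normal_prime_order_central:
  assumes nil: "nilpotent_group G" and p: "Factorial_Ring.prime p"
    and a: "a \<in> carrier G" "a [^] (p::nat) = \<one>"
    and conj: "\<And>g. g \<in> carrier G \<Longrightarrow> g \<otimes> a \<otimes> inv g \<in> generate G {a}"
    and g: "g \<in> carrier G"
  shows "g \<otimes> a = a \<otimes> g"
proof (cases "a = \<one>")
  case False
  obtain i where i: "a \<in> lower_central G i" "a \<notin> lower_central G (Suc i)"
    using nilpotent_deepest_element[OF nil, of "{a}"] a(1) False by auto
  interpret N: normal "lower_central G (Suc i)" G by (rule normal_lower_central)
  let ?w = "g \<otimes> a \<otimes> inv g \<otimes> inv a"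
  have w: "?w \<in> lower_central G (Suc i)" by (rule commutator_in_lower_central[OF g i(1)])
  have "?w \<in> generate G {a}"
    using conj[OF g] subgroup_generate_singleton[OF a(1)]
    by (metis generate.incl insertI1 subgroup.m_closed subgroup.m_inv_closed)
  then obtain k :: int where k: "?w = a [^] k" using mem_generate_singleton_iff[OF a(1)] by blast
  have "?w = \<one>"
  proof (rule ccontr)
    assume "?w \<noteq> \<one>"
    then obtain j :: int where "a = ?w [^] j"
      using prime_order_power_generates[OF p a, of k] k by metis
    then show False using subgroup_int_pow_closed[OF N.is_subgroup w, of j] i(2) by simp
  qed
  then show ?thesis using commute_iff_commutator g a(1) by blast
qed (use g in simp)

text \<open>The counterexample has \<open>N = lower_central G (Suc i)\<close>, \<open>t = a\<close>
  and \<open>F = {generate G {a}}\<close>. Conjugates of \<open>a\<close> agree with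
  \<open>a\<close> modulo \<open>N\<close>, which gives the lifts. A nontrivial element common to
  all conjugates of the subgroup of \<open>a\<close> would make this subgroup normal, hence
  \<open>a\<close> central.\<close>

lemma two_closed_prime_order_central:
  assumes nil: "nilpotent_group G" and fin: "finite (carrier G)"
    and inf: "infinite (UNIV :: 'x set)" and closed: "two_closed_group G TYPE('x)"
    and p: "Factorial_Ring.prime p" and a: "a \<in> carrier G" "a [^] (p::nat) = \<one>"
    and g: "g \<in> carrier G"
  shows "g \<otimes> a = a \<otimes> g"
proof (rule ccontr)
  assume not_comm: "g \<otimes> a \<noteq> a \<otimes> g"
  then have "a \<noteq> \<one>" using g by auto
  then obtain i where i: "a \<in> lower_central G i" "a \<notin> lower_central G (Suc i)"
    using nilpotent_deepest_element[OF nil, of "{a}"] a(1) by auto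
  have "\<not> two_closed_group G TYPE('x)"
  proof (rule not_two_closed_group_normal[OF fin inf normal_lower_central a(1) i(2)])
    show "subgroup K G" if "K \<in> {generate G {a}}" for K
      using that subgroup_generate_singleton[OF a(1)] by simp
  next
    fix h assume h: "h \<in> carrier G"
      and "\<And>K x. K \<in> {generate G {a}} \<Longrightarrow> x \<in> carrier G \<Longrightarrow> inv x \<otimes> h \<otimes> x \<in> K"
    then have conj: "inv x \<otimes> h \<otimes> x \<in> generate G {a}" if "x \<in> carrier G" for x
      using that by simp
    show "h = \<one>"
    proof (rule ccontr)
      assume "h \<noteq> \<one>"
      obtain k :: int where k: "h = a [^] k"
        using conj[OF one_closed] h mem_generate_singleton_iff[OF a(1)] by auto
      then obtain j :: int where j: "a = h [^] j"
        using prime_order_power_generates[OF p a] \<open>h \<noteq> \<one>\<close> by metis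
      have "x \<otimes> a \<otimes> inv x \<in> generate G {a}" if x: "x \<in> carrier G" for x
      proof -
        have "x \<otimes> a \<otimes> inv x = (x \<otimes> h \<otimes> inv x) [^] j"
          using conj_int_pow[OF x h, of j] j by simp
        then show ?thesis
          using conj[of "inv x"] x subgroup_int_pow_closed[OF subgroup_generate_singleton[OF a(1)]] by simp
      qed
      then show False
        using nilpotent_normal_prime_order_central[OF nil p a _ g] not_comm by blast
    qed
  next
    fix K x assume "K \<in> {generate G {a}}" and x: "x \<in> carrier G"
    then show "\<exists>h\<in>K. x \<otimes> h \<otimes> inv x \<otimes> inv a \<in> lower_central G (Suc i)"
      using commutator_in_lower_central[OF x i(1)] generate.incl[of a "{a}"] by blast
  qed
  then show False using closed by contradiction
qed

text \<open>The counterexample has \<open>N = generate G {a}\<close> and \<open>t = b\<close>, and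
  \<open>F\<close> consists of the subgroups of \<open>b\<close> and \<open>a \<otimes> b\<close>.
  Both generators equal \<open>b\<close> modulo \<open>N\<close>, and as \<open>a\<close> and
  \<open>b\<close> are independent, the two subgroups meet trivially. Centrality removes all
  conjugations.\<close>

lemma two_closed_prime_order_unique:
  assumes nil: "nilpotent_group G" and fin: "finite (carrier G)"
    and inf: "infinite (UNIV :: 'x set)" and closed: "two_closed_group G TYPE('x)"
    and p: "Factorial_Ring.prime p" and a: "a \<in> carrier G" "a [^] (p::nat) = \<one>" "a \<noteq> \<one>"
    and b: "b \<in> carrier G" "b [^] p = \<one>"
  shows "b \<in> generate G {a}"
proof (rule ccontr)
  assume b_notin: "b \<notin> generate G {a}"
  note central = two_closed_prime_order_central[OF nil fin inf closed p]
  have comm: "a \<otimes> b = b \<otimes> a" using central[OF b a(1)] .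
  have "b \<noteq> \<one>" using b_notin generate.one by metis
  have ord: "ord a = p" "ord b = p" using ord_eq_prime p a b \<open>b \<noteq> \<one>\<close> by blast+
  have conj: "x \<otimes> c \<otimes> inv x = c"
    if "x \<in> carrier G" "c \<in> carrier G" "c [^] p = \<one>" for x c
    using central[of c x] that by (simp add: m_assoc)
  have ab: "a \<otimes> b \<in> carrier G" "(a \<otimes> b) [^] p = \<one>"
    using a b pow_mult_distrib[OF comm] by simp_all
  have "\<not> two_closed_group G TYPE('x)"
  proof (rule not_two_closed_group_normal[OF fin inf _ b(1) b_notin])
    show "generate G {a} \<lhd> G"
      by (rule normal_generateI) (use a conj in auto)
    show "subgroup K G" if "K \<in> {generate G {b}, generate G {a \<otimes> b}}" for K
      using that subgroup_generate_singleton b(1) ab(1) by auto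
  next
    fix g assume g: "g \<in> carrier G"
      and "\<And>K x. K \<in> {generate G {b}, generate G {a \<otimes> b}} \<Longrightarrow> x \<in> carrier G \<Longrightarrow> inv x \<otimes> g \<otimes> x \<in> K"
    from this(2)[OF _ one_closed] have "g \<in> generate G {b}" "g \<in> generate G {a \<otimes> b}"
      using g by simp_all
    then obtain i j :: int where ij: "g = b [^] i" "g = (a \<otimes> b) [^] j"
      using mem_generate_singleton_iff b(1) ab(1) by metis
    have "a [^] j \<otimes> b [^] j = b [^] i"
      using ij int_pow_mult_distrib[OF comm a(1) b(1), of j] by simp
    then have eq: "a [^] j = b [^] (i - j)"
      using a(1) b(1) by (simp add: int_pow_diff inv_solve_right)
    have "a [^] j = \<one>"
    proof (rule ccontr)
      assume "a [^] j \<noteq> \<one>"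
      then obtain r :: int where "b = (a [^] j) [^] r"
        using prime_order_power_generates[OF p b] eq by metis
      then have "b = a [^] (j * r)" using a(1) by (simp add: int_pow_pow)
      then show False using b_notin mem_generate_singleton_iff[OF a(1)] by blast
    qed
    then have "b [^] j = \<one>" using int_pow_eq_id a(1) b(1) ord by metis
    then show "g = \<one>"
      using ij(2) int_pow_mult_distrib[OF comm a(1) b(1), of j] \<open>a [^] j = \<one>\<close> by simp
  next
    fix K x assume K: "K \<in> {generate G {b}, generate G {a \<otimes> b}}" and x: "x \<in> carrier G"
    have "a \<otimes> b \<otimes> inv b = a" using a b by (simp add: m_assoc)
    then have "x \<otimes> b \<otimes> inv x \<otimes> inv b \<in> generate G {a}"
      "x \<otimes> (a \<otimes> b) \<otimes> inv x \<otimes> inv b \<in> generate G {a}"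
      using conj[OF x b] conj[OF x ab] b(1) by (auto intro: generate.intros)
    then show "\<exists>h\<in>K. x \<otimes> h \<otimes> inv x \<otimes> inv b \<in> generate G {a}"
      using K by (auto intro: generate.intros)
  qed
  then show False using closed by contradiction
qed

end


section \<open>Nilpotent groups with unique subgroups of prime order\<close>

lemma int_cong_solvable:
  fixes a b m :: int
  assumes "coprime a m"
  shows "\<exists>i. m dvd i * a - b"
proof -
  obtain u v where "u * a + v * m = 1" using bezout_int[of a m] assms by auto
  then have "b * u * a - b = m * (- v * b)" by (simp add: algebra_simps) (metis distrib_left mult.left_commute mult.commute mult_1_right)
  then have "m dvd (b * u) * a - b" by (metis dvd_triv_left)
  then show ?thesis by blast
qed

lemma coprimeI_nat_prime:
  fixes a m :: int
  assumes "\<And>p::nat. Factorial_Ring.prime p \<Longrightarrow> int p dvd a \<Longrightarrow> int p dvd m \<Longrightarrow> False"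
  shows "coprime a m"
proof (rule ccontr)
  assume "\<not> coprime a m"
  then have "\<not> is_unit (gcd a m)" by (simp add: coprime_iff_gcd_eq_1)
  then have "nat (gcd a m) \<noteq> 1" by (metis gcd_ge_0_int nat_eq_iff2 of_nat_1 is_unit_gcd_iff coprime_iff_gcd_eq_1 one_dvd)
  then obtain p where p: "Factorial_Ring.prime p" "p dvd nat (gcd a m)" using prime_factor_nat by blast
  then have "int p dvd gcd a m" by (metis gcd_ge_0_int int_dvd_int_iff nat_0_le)
  then show False using assms p(1) by auto
qed

lemma geometric_sum_cong_prime:
  fixes k :: int
  assumes "p dvd k - 1"
  shows "p dvd (\<Sum>j<q. k ^ j) - int q"
proof -
  have "(\<Sum>j<q. k ^ j) - int q = (\<Sum>j<q. k ^ j - 1)" by (simp add: sum_subtractf)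
  also have "p dvd \<dots>"
  proof (rule dvd_sum)
    fix j
    have "k - 1 dvd k ^ j - 1" using power_diff_1_eq[of k j] by (metis dvd_triv_left)
    then show "p dvd k ^ j - 1" using assms dvd_trans by blast
  qed
  finally show ?thesis .
qed

text \<open>Modulo the square of \<open>q\<close>, the power \<open>k ^ j\<close> is
  \<open>1 + j * q * m\<close>. The linear terms add up to \<open>q * m\<close> times
  \<open>q * (q - 1) / 2\<close>, a multiple of the square because \<open>q\<close> is odd. For
  \<open>q = 2\<close> this breaks down, which leaves room for the quaternion groups.\<close>

lemma geometric_sum_cong_square:
  fixes k :: int
  assumes "odd q" "int q dvd k - 1"
  shows "int q ^ 2 dvd (\<Sum>j<q. k ^ j) - int q"
proof -
  obtain m where m: "k = 1 + int q * m" using assms(2) by (metis add.commute diff_add_cancel dvdE)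
  have pow: "int q ^ 2 dvd k ^ j - 1 - int j * (int q * m)" for j
  proof (induction j)
    case (Suc j)
    have "k ^ Suc j - 1 - int (Suc j) * (int q * m) =
      k * (k ^ j - 1 - int j * (int q * m)) + int q ^ 2 * (int j * m ^ 2)"
      unfolding m by (simp add: algebra_simps power2_eq_square)
    then show ?case using Suc by (metis dvd_add dvd_mult dvd_triv_left)
  qed simp
  obtain r where r: "q = 2 * r + 1" using assms(1) by (elim oddE)
  have "int (\<Sum>j<q. j) = int q * int r"
  proof -
    have "2 * (\<Sum>j<n. int j) = int n * (int n - 1)" for n
      by (induction n) (auto simp: algebra_simps)
    from this[of q] show ?thesis unfolding r by (simp add: algebra_simps)
  qed
  then have sum: "(\<Sum>j<q. int j * (int q * m)) = int q ^ 2 * (int r * m)"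
    by (simp add: power2_eq_square mult.assoc mult.left_commute flip: sum_distrib_right)
  have "(\<Sum>j<q. k ^ j) - int q = (\<Sum>j<q. k ^ j - 1 - int j * (int q * m)) + int q ^ 2 * (int r * m)"
    by (simp add: sum_subtractf flip: sum)
  then show ?thesis using pow by (metis (no_types, lifting) dvd_add dvd_sum dvd_triv_left)
qed

text \<open>Here \<open>k\<close> is the exponent by which \<open>g\<close> acts on a self-centralizing cyclic group
  of order \<open>n\<close> with generator \<open>c\<close>, and \<open>g ^ q = c ^ s\<close>; the last hypothesis says that no
  \<open>c ^ i \<cdot> g\<close> has order \<open>q\<close>.\<close>

lemma twisted_root_obstruction:
  fixes k s n :: int
  assumes q: "Factorial_Ring.prime q"
    and unipotent: "\<And>p::nat. Factorial_Ring.prime p \<Longrightarrow> int p dvd n \<Longrightarrow> int p dvd k - 1"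
    and kq: "n dvd k ^ q - 1" and ks: "n dvd (k - 1) * s" and nontriv: "\<not> n dvd k - 1"
    and no_root: "int q dvd n \<Longrightarrow> \<not> (\<exists>i. n dvd i * (\<Sum>j<q. k ^ j) + s)"
    and n: "n = 2 ^ e * m" "odd m"
  shows "q = 2 \<and> e \<ge> 2 \<and> 2 ^ e dvd k + 1 \<and> m dvd k - 1 \<and>
    (\<exists>i. n dvd i * (k + 1) + s - 2 ^ (e - 1) * m)"
proof -
  define \<sigma> where "\<sigma> = (\<Sum>j<q. k ^ j)"
  have k\<sigma>: "n dvd (k - 1) * \<sigma>" using kq power_diff_1_eq[of k q] unfolding \<sigma>_def by simp
  have q_int: "Factorial_Ring.prime (int q)" using q by simp
  \<comment> \<open>Modulo a prime divisor of \<open>n\<close> the sum \<sigma> is congruent to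
    \<open>q\<close>, so only \<open>q\<close> can divide both \<sigma> and
    \<open>n\<close>.\<close>
  have p_\<sigma>: "p = q" if "Factorial_Ring.prime p" "int p dvd n" "int p dvd \<sigma>" for p :: nat
  proof -
    have "int p dvd int q"
      using geometric_sum_cong_prime[OF unipotent[OF that(1,2)], of q] that(3)
      unfolding \<sigma>_def by (metis dvd_diff_right_iff dvd_minus_iff minus_diff_eq)
    then show ?thesis using that(1) q by (metis int_dvd_int_iff primes_dvd_imp_eq)
  qed
  have qn: "int q dvd n"
  proof (rule ccontr)
    assume "\<not> int q dvd n"
    then have "coprime \<sigma> n" using p_\<sigma> by (intro coprimeI_nat_prime) auto
    then show False using k\<sigma> nontriv by (metis coprime_commute coprime_dvd_mult_left_iff)
  qed
  have no_root: "\<not> n dvd i * \<sigma> + s" for i using no_root[OF qn] unfolding \<sigma>_def by blast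
  \<comment> \<open>If \<open>q\<close> divides \<sigma> exactly once, then \<tau> is invertible
    modulo \<open>n\<close>. Hence \<open>n\<close> divides \<open>(k - 1) * q\<close>; together
    with \<open>ks\<close> and \<open>nontriv\<close> this forces \<open>q\<close> to divide
    \<open>s\<close>, and the excluded congruence becomes solvable.\<close>
  have tame: False if \<tau>: "\<sigma> = int q * \<tau>" "\<not> int q dvd \<tau>" for \<tau>
  proof -
    have cop: "coprime \<tau> n"
    proof (rule coprimeI_nat_prime)
      fix p :: nat assume p: "Factorial_Ring.prime p" "int p dvd \<tau>" "int p dvd n"
      then have "p = q" using p_\<sigma>[of p] \<tau>(1) by simp
      then show False using p(2) \<tau>(2) by simp
    qed
    have "n dvd ((k - 1) * int q) * \<tau>" using k\<sigma> \<tau>(1) by (simp add: mult.assoc)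
    then have kq': "n dvd (k - 1) * int q"
      using cop by (metis coprime_commute coprime_dvd_mult_left_iff)
    have "int q dvd s"
    proof (rule ccontr)
      assume "\<not> int q dvd s"
      then have "coprime (int q) s" using q_int by (simp add: prime_imp_coprime)
      then obtain u v where "u * int q + v * s = 1" using bezout_int[of "int q" s] by auto
      then have "k - 1 = u * ((k - 1) * int q) + v * ((k - 1) * s)"
      proof -
        have "u * ((k - 1) * int q) + v * ((k - 1) * s) = (k - 1) * (u * int q + v * s)"
          by (simp add: algebra_simps)
        then show ?thesis using \<open>u * int q + v * s = 1\<close> by simp
      qed
      then show False using kq' ks nontriv by (metis dvd_add dvd_mult)
    qed
    then obtain s' where s': "s = int q * s'" by (elim dvdE)
    obtain i where "n dvd i * \<tau> - (- s')" using int_cong_solvable[OF cop] by blast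
    then have "n dvd int q * (i * \<tau> - (- s'))" by (rule dvd_mult)
    also have "int q * (i * \<tau> - (- s')) = i * \<sigma> + s" unfolding \<tau>(1) s' by (simp add: algebra_simps)
    finally show False using no_root by blast
  qed
  have qk: "int q dvd k - 1" using unipotent[OF q qn] .
  have q_\<sigma>: "int q dvd \<sigma>"
    using geometric_sum_cong_prime[OF qk, of q] unfolding \<sigma>_def by (simp add: dvd_diff_left_iff)
  have "q = 2"
  proof (rule ccontr)
    assume "q \<noteq> 2"
    then have "odd q" using q prime_odd_nat prime_ge_2_nat by (metis le_neq_implies_less)
    obtain \<tau> where \<tau>: "\<sigma> = int q * \<tau>" using q_\<sigma> by (elim dvdE)
    have "int q * int q dvd int q * (\<tau> - 1)"
      using geometric_sum_cong_square[OF \<open>odd q\<close> qk] \<tau> unfolding \<sigma>_def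
      by (simp add: power2_eq_square right_diff_distrib)
    then have "int q dvd \<tau> - 1" using q by (auto simp: prime_gt_0_nat)
    then have "\<not> int q dvd \<tau>" using q_int by (metis dvd_diff_right_iff not_prime_unit)
    then show False using tame \<tau> by blast
  qed
  have \<sigma>: "\<sigma> = k + 1" unfolding \<sigma>_def \<open>q = 2\<close> by (simp add: numeral_2_eq_2)
  have "odd k" using qk \<open>q = 2\<close> by simp
  \<comment> \<open>For \<open>k mod 4 = 1\<close> the sum \<open>\<sigma> = k + 1\<close> is twice
    an odd number, which is the excluded tame case.\<close>
  have four: "k mod 4 = 3"
  proof (rule ccontr)
    assume "k mod 4 \<noteq> 3"
    then have "k mod 4 = 1" using \<open>odd k\<close> by presburger
    then obtain r where "k = 4 * r + 1" by (metis mult_div_mod_eq)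
    then show False using tame[of "2 * r + 1"] unfolding \<sigma> \<open>q = 2\<close> by simp
  qed
  then obtain r where r: "k = 4 * r + 3" by (metis mult_div_mod_eq)
  have "e \<noteq> 0" using qn \<open>q = 2\<close> n by (intro notI) simp
  then obtain f where f: "e = Suc f" by (metis not0_implies_Suc)
  have n2: "n = 2 * 2 ^ f * m" using n f by simp
  have prime_m: False if "Factorial_Ring.prime p" "int p dvd k + 1" "int p dvd m" for p :: nat
  proof -
    have "p = q" using p_\<sigma> that n unfolding \<sigma> by auto
    then show False using \<open>q = 2\<close> that(3) n(2) by simp
  qed
  have cop_m: "coprime (k + 1) m" using prime_m by (intro coprimeI_nat_prime) auto
  have mk: "m dvd k - 1"
  proof -
    have "m dvd (k - 1) * (k + 1)" using k\<sigma> n unfolding \<sigma> by (metis dvd_mult_right)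
    then show ?thesis using cop_m by (metis coprime_commute coprime_dvd_mult_left_iff)
  qed
  have odd_half: "odd (2 * r + 1)" by simp
  \<comment> \<open>Here \<open>k - 1\<close> is twice an odd number, so cancelling it costs exactly
    one factor 2 of \<open>n\<close>. This is applied to \<open>s\<close> and to \<sigma>.\<close>
  have half: "(2::int) ^ f dvd t" if "n dvd (k - 1) * t" for t
  proof -
    have "(k - 1) * t = 2 * ((2 * r + 1) * t)" unfolding r by (simp add: algebra_simps)
    moreover have "2 * 2 ^ f dvd (k - 1) * t" using that unfolding n2 by (rule dvd_mult_left)
    ultimately have "2 * 2 ^ f dvd 2 * ((2 * r + 1) * t)" by (simp only:)
    then have "2 ^ f dvd (2 * r + 1) * t" by (simp only: dvd_mult_cancel_left) simp
    moreover have "coprime ((2::int) ^ f) (2 * r + 1)" by simp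
    ultimately show ?thesis by (metis coprime_dvd_mult_right_iff)
  qed
  obtain s' where s': "s = 2 ^ f * s'" using half[OF ks] by (elim dvdE)
  obtain \<kappa> where \<kappa>: "k + 1 = 2 ^ f * \<kappa>" using half[OF k\<sigma>] unfolding \<sigma> by (elim dvdE)
  have cop_\<kappa>: "coprime \<kappa> m" using cop_m unfolding \<kappa> by simp
  have "f \<noteq> 0"
  proof
    assume "f = 0"
    then have "n dvd k - 1"
      using n2 mk \<open>odd k\<close> n(2) by (simp add: divides_mult)
    then show False using nontriv by blast
  qed
  \<comment> \<open>Otherwise \<kappa> is invertible modulo \<open>2 * m\<close> and the excluded
    congruence is solvable. Evenness raises the divisor \<open>2 ^ f\<close> of \<open>k + 1\<close>
    to \<open>2 ^ e\<close>.\<close>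
  have "even \<kappa>"
  proof (rule ccontr)
    assume "odd \<kappa>"
    then have "coprime \<kappa> (2 * m)" using cop_\<kappa> by simp
    then obtain i where "2 * m dvd i * \<kappa> - (- s')" using int_cong_solvable by blast
    then have "2 ^ f * (2 * m) dvd 2 ^ f * (i * \<kappa> - (- s'))" by (rule mult_dvd_mono[OF dvd_refl])
    then have "n dvd i * \<sigma> + s" unfolding \<sigma> \<kappa> s' n2 by (simp add: algebra_simps)
    then show False using no_root by blast
  qed
  then obtain \<mu> where \<mu>: "\<kappa> = 2 * \<mu>" by (elim evenE)
  have cop_\<mu>: "coprime \<mu> m" using cop_\<kappa> unfolding \<mu> by simp
  have "odd s'"
  proof
    assume "even s'"
    then obtain s'' where s'': "s' = 2 * s''" by (elim evenE)
    obtain i where "m dvd i * \<mu> - (- s'')" using int_cong_solvable[OF cop_\<mu>] by blast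
    then have "2 ^ f * 2 * m dvd 2 ^ f * 2 * (i * \<mu> - (- s''))" by (rule mult_dvd_mono[OF dvd_refl])
    then have "n dvd i * \<sigma> + s" unfolding \<sigma> \<kappa> \<mu> s' s'' n2 by (simp add: algebra_simps)
    then show False using no_root by blast
  qed
  \<comment> \<open>Both \<open>m\<close> and \<open>s'\<close> are odd. Solving for
    \<open>d\<close> modulo \<open>m\<close> makes \<open>i * \<sigma> + s\<close> congruent to
    \<open>2 ^ f * m\<close>, the exponent of the involution in a cyclic group of order
    \<open>n\<close>.\<close>
  then obtain d where d: "m - s' = 2 * d" using n(2) by (metis even_diff evenE odd_even_add)
  obtain i where "m dvd i * \<mu> - d" using int_cong_solvable[OF cop_\<mu>] by blast
  then have "2 ^ f * 2 * m dvd 2 ^ f * 2 * (i * \<mu> - d)" by (rule mult_dvd_mono[OF dvd_refl])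
  also have "2 ^ f * 2 * (i * \<mu> - d) = i * (k + 1) + s - 2 ^ (e - 1) * m"
  proof -
    have "2 ^ f * 2 * (i * \<mu> - d) = i * (2 ^ f * (2 * \<mu>)) - 2 ^ f * (2 * d)" by (simp add: algebra_simps)
    then show ?thesis unfolding \<kappa> \<mu> s' f d[symmetric] by (simp add: algebra_simps)
  qed
  finally have "n dvd i * (k + 1) + s - 2 ^ (e - 1) * m" unfolding n2 by (simp add: mult.commute)
  moreover have "2 ^ e dvd k + 1" unfolding \<kappa> \<mu> f by simp
  ultimately show ?thesis using \<open>q = 2\<close> \<open>f \<noteq> 0\<close> f mk by auto
qed


section \<open>Powers of elements that normalize a cyclic subgroup\<close>

context group
begin

text \<open>For the least positive \<open>r\<close> with \<open>x [^] r\<close> in \<open>H\<close>,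
  a prime divisor \<open>p\<close> of \<open>r\<close> yields the element
  \<open>x [^] (r div p)\<close> of order \<open>p\<close> modulo \<open>H\<close>.\<close>

lemma minimal_root_exponent:
  assumes fin: "finite (carrier G)" and H: "subgroup H G" and x: "x \<in> carrier G" "x \<notin> H"
  obtains r :: nat where "r > 1" "x [^] r \<in> H"
    "\<And>p. Factorial_Ring.prime p \<Longrightarrow> p dvd r \<Longrightarrow> x [^] (r div p) \<notin> H"
proof -
  define r where "r = (LEAST r::nat. 0 < r \<and> x [^] r \<in> H)"
  have "0 < ord x \<and> x [^] ord x \<in> H"
    using ord_ge_1[OF fin x(1)] x(1) subgroup.one_closed[OF H] by simp
  then have r: "0 < r \<and> x [^] r \<in> H" unfolding r_def by (rule LeastI)
  have "r \<noteq> 1" using r x by auto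
  moreover have "x [^] (r div p) \<notin> H" if p: "Factorial_Ring.prime p" "p dvd r" for p
  proof
    assume "x [^] (r div p) \<in> H"
    moreover have "0 < r div p" using p r prime_gt_0_nat by (metis dvd_div_eq_0_iff gr0I less_numeral_extra(3))
    ultimately have "r \<le> r div p" unfolding r_def by (intro Least_le) simp
    then show False using r prime_gt_1_nat[OF p(1)] by (metis div_less_dividend leD)
  qed
  ultimately show thesis using that[of r] r by auto
qed

lemma twisted_power:
  assumes c: "c \<in> carrier G" and g: "g \<in> carrier G" and k: "g \<otimes> c \<otimes> inv g = c [^] (k::int)"
  shows "g [^] (n::nat) \<otimes> c [^] (i::int) = c [^] (k ^ n * i) \<otimes> g [^] n"
proof (induction n arbitrary: i)
  case 0
  then show ?case using c by simp
next
  case (Suc n)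
  have "g \<otimes> c [^] i \<otimes> inv g = c [^] (k * i)"
    using conj_int_pow[OF g c, of i] c unfolding k by (simp add: int_pow_pow)
  then have "g \<otimes> c [^] i = c [^] (k * i) \<otimes> g"
    using c g by (metis int_pow_closed inv_solve_right' m_closed)
  then have "g [^] Suc n \<otimes> c [^] i = g [^] n \<otimes> c [^] (k * i) \<otimes> g"
    using c g by (simp add: m_assoc)
  also have "\<dots> = c [^] (k ^ Suc n * i) \<otimes> g [^] Suc n"
    unfolding Suc.IH using c g by (simp add: m_assoc mult.assoc mult.left_commute)
  finally show ?case .
qed

text \<open>Moving a factor \<open>g\<close> past a power of \<open>c\<close> multiplies the
  exponent by \<open>k\<close>; collecting all powers of \<open>c\<close> on the left produces a
  geometric sum.\<close>

lemma twisted_product_power: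
  assumes c: "c \<in> carrier G" and g: "g \<in> carrier G" and k: "g \<otimes> c \<otimes> inv g = c [^] (k::int)"
  shows "(c [^] (i::int) \<otimes> g) [^] (n::nat) = c [^] (i * (\<Sum>j<n. k ^ j)) \<otimes> g [^] n"
proof (induction n)
  case 0
  then show ?case using c by simp
next
  case (Suc n)
  have "(c [^] i \<otimes> g) [^] Suc n = c [^] (i * (\<Sum>j<n. k ^ j)) \<otimes> (g [^] n \<otimes> c [^] i) \<otimes> g"
    using Suc c g by (simp add: m_assoc)
  also have "\<dots> = c [^] (i * (\<Sum>j<n. k ^ j)) \<otimes> c [^] (k ^ n * i) \<otimes> g [^] Suc n"
    unfolding twisted_power[OF c g k] using c g by (simp add: m_assoc)
  also have "c [^] (i * (\<Sum>j<n. k ^ j)) \<otimes> c [^] (k ^ n * i) = c [^] (i * (\<Sum>j<Suc n. k ^ j))"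
    using c by (simp add: distrib_left mult.commute flip: int_pow_mult)
  finally show ?case .
qed

end

section \<open>A self-centralizing normal cyclic subgroup\<close>

text \<open>The assumption \<open>unique\<close> records what the structure theory takes over from
  2-closedness.\<close>

locale nilpotent_unique_prime_subgroup = group +
  assumes nil: "nilpotent_group G" and fin: "finite (carrier G)"
    and unique: "\<And>p a b. Factorial_Ring.prime (p::nat) \<Longrightarrow> a \<in> carrier G \<Longrightarrow> a [^] p = \<one> \<Longrightarrow>
      a \<noteq> \<one> \<Longrightarrow> b \<in> carrier G \<Longrightarrow> b [^] p = \<one> \<Longrightarrow> b \<in> generate G {a}"
begin

text \<open>The power \<open>c [^] (ord c div q)\<close> has order \<open>q\<close>, and its
  subgroup is the only one of that order.\<close>

lemma prime_order_in_cyclic: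
  assumes c: "c \<in> carrier G" and q: "Factorial_Ring.prime q" "q dvd ord c"
    and w: "w \<in> carrier G" "w [^] (q::nat) = \<one>"
  shows "w \<in> generate G {c}"
proof -
  let ?a = "c [^] (ord c div q)"
  have "ord c > 0" using ord_ge_1[OF fin c] by simp
  have "?a [^] q = \<one>" using q c by (simp add: nat_pow_pow)
  moreover have "?a \<noteq> \<one>"
    using pow_eq_id[OF c] q \<open>ord c > 0\<close> prime_gt_1_nat[OF q(1)]
    by (metis div_less_dividend dvd_div_eq_0_iff gr0I nat_dvd_not_less)
  ultimately have "w \<in> generate G {?a}" using unique[OF q(1), of ?a w] c w by simp
  then obtain i :: int where "w = ?a [^] i" using mem_generate_singleton_iff c by blast
  also have "\<dots> = c [^] (int (ord c div q) * i)"
    using c by (simp add: int_pow_pow flip: int_pow_int)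
  finally show ?thesis using mem_generate_singleton_iff[OF c] by blast
qed

text \<open>Take \<open>\<langle>c\<rangle>\<close> largest among the normal cyclic subgroups. An \<open>x\<close> outside \<open>\<langle>c\<rangle>\<close> that centralizes \<open>c\<close>
  and lies as deep as possible in the lower central series is central modulo \<open>\<langle>c\<rangle>\<close>. Hence the cyclic
  subgroups of \<open>\<langle>c, x\<rangle>\<close> that contain \<open>c\<close> are normal too, and equal to \<open>\<langle>c\<rangle>\<close> by maximality.\<close>

lemma self_centralizing_cyclic:
  obtains c where "c \<in> carrier G" "generate G {c} \<lhd> G"
    "\<And>x. x \<in> carrier G \<Longrightarrow> x \<otimes> c = c \<otimes> x \<Longrightarrow> x \<in> generate G {c}"
proof -
  define C where "C = {c \<in> carrier G. \<forall>g\<in>carrier G. g \<otimes> c \<otimes> inv g \<in> generate G {c}}"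
  have "\<one> \<in> C" unfolding C_def by (auto intro: generate.one)
  have finC: "finite C" unfolding C_def using fin by simp
  let ?f = "\<lambda>c. card (generate G {c})"
  have "Max (?f ` C) \<in> ?f ` C" using finC \<open>\<one> \<in> C\<close> by (intro Max_in) auto
  then obtain c where cC: "c \<in> C" "?f c = Max (?f ` C)" by auto
  define Z where "Z = generate G {c}"
  have c: "c \<in> carrier G" using cC unfolding C_def by blast
  have Zsub: "subgroup Z G" unfolding Z_def by (rule subgroup_generate_singleton[OF c])
  have Z_iff: "z \<in> Z \<longleftrightarrow> (\<exists>i::int. z = c [^] i)" for z
    unfolding Z_def by (rule mem_generate_singleton_iff[OF c])
  have cZ: "c \<in> Z" unfolding Z_def by (simp add: generate.incl)
  have maximal: "u \<in> Z" if u: "u \<in> C" "c \<in> generate G {u}" for u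
  proof -
    have uc: "u \<in> carrier G" using u(1) unfolding C_def by blast
    have sub: "Z \<subseteq> generate G {u}"
      unfolding Z_def using generate_subgroup_incl[OF _ subgroup_generate_singleton[OF uc], of "{c}"] u(2) by simp
    have "finite (generate G {u})"
      using fin subgroup.subset[OF subgroup_generate_singleton[OF uc]] finite_subset by blast
    moreover have "?f u \<le> card Z" unfolding Z_def cC(2) using finC u(1) by (intro Max_ge) auto
    ultimately have "Z = generate G {u}" using sub by (intro card_seteq)
    then show ?thesis using generate.incl[of u "{u}"] by simp
  qed
  have Zconj: "g \<otimes> z \<otimes> inv g \<in> Z" if gz: "g \<in> carrier G" "z \<in> Z" for g z
  proof -
    obtain i :: int where i: "z = c [^] i" using gz(2) Z_iff by blast
    have "g \<otimes> c \<otimes> inv g \<in> Z" using cC(1) gz(1) unfolding C_def Z_def by blast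
    then show ?thesis
      unfolding i conj_int_pow[OF gz(1) c] by (rule subgroup_int_pow_closed[OF Zsub])
  qed
  have normal: "Z \<lhd> G" using normal_invI[OF Zsub] Zconj by blast
  define S where "S = {x \<in> carrier G. x \<otimes> c = c \<otimes> x \<and> x \<notin> Z}"
  have "S = {}"
  proof (rule ccontr)
    assume "S \<noteq> {}"
    moreover have "\<one> \<notin> S" unfolding S_def using subgroup.one_closed[OF Zsub] by simp
    moreover have "S \<subseteq> carrier G" unfolding S_def by blast
    ultimately obtain i x where x: "x \<in> S" "x \<in> lower_central G i" "S \<inter> lower_central G (Suc i) = {}"
      using nilpotent_deepest_element[OF nil] by metis
    have xc: "x \<in> carrier G" "x \<otimes> c = c \<otimes> x" "x \<notin> Z" using x(1) unfolding S_def by auto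
    \<comment> \<open>The conjugate \<open>?v\<close> commutes with \<open>c\<close> because
      \<open>x\<close> commutes with \<open>c'\<close>, a power of \<open>c\<close>. So the
      commutator \<open>?w\<close> centralizes \<open>c\<close>; being deeper in the series than
      \<open>x\<close>, it is not in \<open>S\<close> and must lie in \<open>Z\<close>.\<close>
    have x_conj: "\<exists>m::int. g \<otimes> x \<otimes> inv g = c [^] m \<otimes> x" if g: "g \<in> carrier G" for g
    proof -
      let ?v = "g \<otimes> x \<otimes> inv g"
      have v: "?v \<in> carrier G" using g xc(1) by simp
      define c' where "c' = inv g \<otimes> c \<otimes> g"
      have "c' \<in> Z" unfolding c'_def using Zconj[of "inv g" c] g cZ by simp
      then obtain l :: int where l: "c' = c [^] l" using Z_iff by blast
      have c': "c' \<in> carrier G" unfolding l using c by simp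
      have "g \<otimes> c' \<otimes> inv g = (g \<otimes> inv g) \<otimes> c \<otimes> (g \<otimes> inv g)"
        unfolding c'_def using g c by (simp only: m_assoc m_closed inv_closed)
      then have gc': "g \<otimes> c' \<otimes> inv g = c" using g c by simp
      have comm: "x \<otimes> c' = c' \<otimes> x"
        unfolding l using int_pow_commute[of c x l] xc c by simp
      have v_comm: "?v \<otimes> c = c \<otimes> ?v"
        using conj_mult[OF g xc(1) c'] conj_mult[OF g c' xc(1)] comm unfolding gc' by simp
      have x_comm: "inv x \<otimes> c = c \<otimes> inv x"
        using int_pow_commute[OF xc(2,1) c, of "-1"] xc(1) by (simp add: int_pow_neg)
      let ?w = "?v \<otimes> inv x"
      have ix: "inv x \<in> carrier G" using xc(1) by simp
      have "?w \<otimes> c = ?v \<otimes> (c \<otimes> inv x)"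
        unfolding x_comm[symmetric] using m_assoc[OF v ix c] .
      also have "\<dots> = c \<otimes> ?v \<otimes> inv x"
        unfolding v_comm[symmetric] using m_assoc[OF v c ix] by (rule sym)
      also have "\<dots> = c \<otimes> ?w" using m_assoc[OF c v ix] .
      finally have "?w \<otimes> c = c \<otimes> ?w" .
      moreover have "?w \<notin> S" using commutator_in_lower_central[OF g x(2)] x(3) by blast
      ultimately have "?w \<in> Z" using m_closed[OF v ix] unfolding S_def mem_Collect_eq by argo
      then obtain m :: int where "?w = c [^] m" using Z_iff by blast
      then have "?v = c [^] m \<otimes> x" using v xc(1) c by (metis inv_solve_right' int_pow_closed)
      then show ?thesis by blast
    qed
    obtain r :: nat where r: "r > 1" "x [^] r \<in> Z"
      "\<And>p. Factorial_Ring.prime p \<Longrightarrow> p dvd r \<Longrightarrow> x [^] (r div p) \<notin> Z"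
      using minimal_root_exponent[OF fin Zsub xc(1,3)] by blast
    obtain q where q: "Factorial_Ring.prime q" "q dvd r"
      using prime_factor_nat[of r] r(1) by auto
    define t where "t = r div q"
    define y where "y = x [^] t"
    have y: "y \<in> carrier G" "y \<notin> Z" unfolding y_def t_def using xc(1) r(3)[OF q] by simp_all
    have "y [^] q \<in> Z" unfolding y_def t_def using q(2) r(2) xc(1) by (simp add: nat_pow_pow)
    then obtain s :: int where "y [^] q = c [^] s" using Z_iff by blast
    then have s: "y [^] int q = c [^] s" by (simp add: int_pow_int)
    have yc: "c \<otimes> y = y \<otimes> c"
      unfolding y_def using group_commutes_pow[OF xc(2) xc(1) c] by simp
    have cy: "c [^] a \<otimes> y [^] b = y [^] b \<otimes> c [^] a" for a b :: int
      using int_pow_commute[OF int_pow_commute[OF yc c y(1), of a, symmetric], of b] c y(1) by simp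
    have u_pow: "(c [^] a \<otimes> y [^] b) [^] n = c [^] (a * n) \<otimes> y [^] (b * n)" for a b n :: int
      using int_pow_mult_distrib[OF cy] c y(1) by (simp add: int_pow_pow)
    have u_pow_q: "(c [^] a \<otimes> y [^] b) [^] int q = c [^] (a * int q + s * b)" for a b :: int
    proof -
      have "y [^] (b * int q) = c [^] (s * b)"
        using s y(1) c by (metis int_pow_pow mult.commute)
      then show ?thesis unfolding u_pow using c by (simp add: int_pow_mult)
    qed
    \<comment> \<open>Conjugation multiplies \<open>?u\<close> by a power of \<open>c\<close>. If
      \<open>c\<close> is itself a power of \<open>?u\<close>, then \<open>?u\<close> generates a
      normal subgroup and maximality applies.\<close>
    have u_mem: "c [^] a \<otimes> y [^] b \<in> Z" if cu: "c \<in> generate G {c [^] a \<otimes> y [^] b}" for a b :: int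
    proof (rule maximal[OF _ cu])
      let ?u = "c [^] a \<otimes> y [^] b"
      have u: "?u \<in> carrier G" using c y by simp
      have "g \<otimes> ?u \<otimes> inv g \<in> generate G {?u}" if g: "g \<in> carrier G" for g
      proof -
        have "c [^] a \<in> Z" using Z_iff by blast
        then obtain a' :: int where a': "g \<otimes> c [^] a \<otimes> inv g = c [^] a'"
          using Zconj[OF g] Z_iff by blast
        obtain m :: int where m: "g \<otimes> x \<otimes> inv g = c [^] m \<otimes> x" using x_conj[OF g] by blast
        have "c [^] m \<otimes> x = x \<otimes> c [^] m" using int_pow_commute[of c x m] xc c by simp
        then have "g \<otimes> x [^] int t \<otimes> inv g = c [^] (m * int t) \<otimes> x [^] int t"
          unfolding conj_int_pow[OF g xc(1)] m
          using int_pow_mult_distrib xc(1) c by (simp add: int_pow_pow)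
        then have gy: "g \<otimes> y \<otimes> inv g = c [^] (m * int t) \<otimes> y [^] (1::int)"
          unfolding y_def using xc(1) by (simp add: int_pow_int)
        have "g \<otimes> y [^] b \<otimes> inv g = c [^] (m * int t * b) \<otimes> y [^] b"
          unfolding conj_int_pow[OF g y(1)] gy u_pow by simp
        then have "g \<otimes> ?u \<otimes> inv g = c [^] a' \<otimes> (c [^] (m * int t * b) \<otimes> y [^] b)"
          using conj_mult[OF g, of "c [^] a" "y [^] b"] c y(1) a' by simp
        also have "\<dots> = c [^] (a' + m * int t * b - a + a) \<otimes> y [^] b"
          using c y(1) by (simp add: int_pow_mult m_assoc)
        also have "\<dots> = c [^] (a' + m * int t * b - a) \<otimes> ?u"
          using c y(1) by (simp only: int_pow_mult m_assoc int_pow_closed)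
        finally have eq: "g \<otimes> ?u \<otimes> inv g = c [^] (a' + m * int t * b - a) \<otimes> ?u" .
        show ?thesis unfolding eq
          using subgroup.m_closed[OF subgroup_generate_singleton[OF u]]
            subgroup_int_pow_closed[OF subgroup_generate_singleton[OF u] cu]
            generate.incl[of ?u "{?u}"] by blast
      qed
      then show "?u \<in> C" using u unfolding C_def by blast
    qed
    have y_mem: False if "c [^] a \<otimes> y \<in> Z" for a :: int
    proof -
      have "inv (c [^] a) \<otimes> (c [^] a \<otimes> y) \<in> Z"
        using that Z_iff subgroup.m_closed[OF Zsub] subgroup.m_inv_closed[OF Zsub] by blast
      then show False using y c by (simp flip: m_assoc)
    qed
    let ?N = "int (ord c)"
    have c_eq: "c [^] i = c [^] j" if "?N dvd j - i" for i j :: int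
      using int_pow_eq[OF c] that by blast
    have q_int: "Factorial_Ring.prime (int q)" using q(1) by simp
    have coprime_q: "\<exists>\<alpha> \<beta>. \<alpha> * int q + \<beta> * n = 1" if "\<not> int q dvd n" for n
      using bezout_int[of "int q" n] prime_imp_coprime[OF q_int that] by auto
    show False
    proof (cases "int q dvd ?N")
      case False
      then obtain \<alpha> \<beta> where ab: "\<alpha> * int q + \<beta> * ?N = 1" using coprime_q by blast
      \<comment> \<open>The exponent is chosen to give \<open>?u\<close> the same
        \<open>q\<close>-th power as \<open>c\<close>. Since \<alpha> inverts \<open>q\<close>
        modulo the order of \<open>c\<close>, this makes \<open>c\<close> a power of
        \<open>?u\<close>.\<close>
      let ?u = "c [^] (1 - s * \<alpha>) \<otimes> y [^] (1::int)"
      have u: "?u \<in> carrier G" using c y(1) by simp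
      have "?u [^] int q = c [^] ((1 - s * \<alpha>) * int q + s * 1)" by (rule u_pow_q)
      also have "\<dots> = c [^] int q"
      proof (rule c_eq)
        have "s = s * (\<alpha> * int q + \<beta> * ?N)" unfolding ab by simp
        then have "int q - ((1 - s * \<alpha>) * int q + s * 1) = ?N * (- s * \<beta>)"
          by (simp add: algebra_simps)
        then show "?N dvd int q - ((1 - s * \<alpha>) * int q + s * 1)" by (metis dvd_triv_left)
      qed
      finally have "?u [^] (int q * \<alpha>) = c [^] (int q * \<alpha>)"
        using u c by (metis int_pow_pow)
      also have "\<dots> = c [^] (1::int)"
      proof (rule c_eq)
        have "1 - int q * \<alpha> = ?N * \<beta>" using ab by (simp add: algebra_simps)
        then show "?N dvd 1 - int q * \<alpha>" by (metis dvd_triv_left)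
      qed
      finally have "c \<in> generate G {?u}"
        unfolding mem_generate_singleton_iff[OF u] using c by (metis int_pow_1)
      then have "c [^] (1 - s * \<alpha>) \<otimes> y \<in> Z" using u_mem y(1) by fastforce
      then show False by (rule y_mem)
    next
      case True
      show False
      proof (cases "int q dvd s")
        case False
        then obtain \<alpha> \<beta> where ab: "\<alpha> * int q + \<beta> * s = 1" using coprime_q by blast
        \<comment> \<open>By the Bezout identity \<open>c\<close> is the \<open>q\<close>-th power
          of \<open>?u\<close>. Inside \<open>Z\<close> such a root cannot exist, because
          \<open>q\<close> divides the order of \<open>c\<close>.\<close>
        let ?u = "c [^] \<alpha> \<otimes> y [^] \<beta>"
        have u: "?u \<in> carrier G" using c y(1) by simp
        have uq: "?u [^] int q = c" using u_pow_q[of \<alpha> \<beta>] ab c by (simp add: mult.commute)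
        then have "c \<in> generate G {?u}"
          unfolding mem_generate_singleton_iff[OF u] by metis
        then have "?u \<in> Z" by (rule u_mem)
        then obtain l :: int where "?u = c [^] l" using Z_iff by blast
        then have "c [^] (1::int) = c [^] (l * int q)" using uq c by (simp add: int_pow_pow)
        then have "?N dvd l * int q - 1" using int_pow_eq[OF c] by blast
        then have "int q dvd l * int q - 1" using True dvd_trans by blast
        then have "int q dvd 1" by (metis dvd_diff_right_iff dvd_triv_right)
        then show False using q_int not_prime_unit by blast
      next
        case True2: True
        then obtain s' where s': "s = int q * s'" by (elim dvdE)
        \<comment> \<open>The factor cancels \<open>s\<close>: the \<open>q\<close>-th power of
          \<open>?w\<close> is trivial, so \<open>?w\<close> lies in \<open>Z\<close> by uniqueness
          of the subgroup of order \<open>q\<close>.\<close>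
        let ?w = "c [^] (- s') \<otimes> y [^] (1::int)"
        have "?w [^] int q = c [^] (- s' * int q + s * 1)" by (rule u_pow_q)
        then have "?w [^] q = \<one>" unfolding s' by (simp add: int_pow_int)
        then have "?w \<in> Z"
          unfolding Z_def using prime_order_in_cyclic[OF c q(1)] True c y(1) by simp
        then show False using y_mem y(1) by simp
      qed
    qed
  qed
  then show thesis
    using that[OF c] normal unfolding Z_def S_def by blast
qed

end


section \<open>Elements outside the self-centralizing subgroup\<close>

context nilpotent_unique_prime_subgroup
begin

text \<open>This is the group form of \<open>twisted_root_obstruction\<close>. The exponent
  \<open>k\<close> is 1 modulo each prime divisor of the order because subgroups of prime order in
  the normal subgroup of \<open>c\<close> are central. The other congruences express that
  \<open>g [^] q\<close> commutes with \<open>c\<close> and with \<open>g\<close>.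
  Self-centralization gives nontriviality, and a root \<open>c [^] i \<otimes> g\<close> of order
  \<open>q\<close> would lie in the subgroup of \<open>c\<close>.\<close>

lemma square_root_structure:
  assumes c: "c \<in> carrier G" and normal: "generate G {c} \<lhd> G"
    and self_cent: "\<And>x. x \<in> carrier G \<Longrightarrow> x \<otimes> c = c \<otimes> x \<Longrightarrow> x \<in> generate G {c}"
    and g: "g \<in> carrier G" "g \<notin> generate G {c}" and k: "g \<otimes> c \<otimes> inv g = c [^] (k::int)"
    and q: "Factorial_Ring.prime q" "g [^] (q::nat) \<in> generate G {c}"
    and ord_c: "ord c = 2 ^ e * m" "odd m"
  shows "q = 2 \<and> e \<ge> 2 \<and> 2 ^ e dvd k + 1 \<and> int m dvd k - 1 \<and>
    (\<exists>i::int. (c [^] i \<otimes> g) [^] (2::nat) = c [^] (2 ^ (e - 1) * int m))"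
proof -
  let ?n = "int (ord c)"
  note mem_iff = mem_generate_singleton_iff[OF c]
  interpret Z: normal "generate G {c}" G by (rule normal)
  obtain s :: int where s: "g [^] q = c [^] s" using q(2) mem_iff by blast
  have pow_c: "g [^] (n::nat) \<otimes> c [^] i = c [^] (k ^ n * i) \<otimes> g [^] n" for n and i :: int
    by (rule twisted_power[OF c g(1) k])
  have g_mem: False if "c [^] i \<otimes> g \<in> generate G {c}" for i :: int
  proof -
    have "inv (c [^] i) \<otimes> (c [^] i \<otimes> g) \<in> generate G {c}"
      using that mem_iff Z.m_closed Z.m_inv_closed by blast
    then show False using g c by (simp flip: m_assoc)
  qed
  have "q = 2 \<and> e \<ge> 2 \<and> 2 ^ e dvd k + 1 \<and> int m dvd k - 1 \<and>
    (\<exists>i. ?n dvd i * (k + 1) + s - 2 ^ (e - 1) * int m)"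
  proof (rule twisted_root_obstruction[OF q(1)])
    fix p :: nat assume p: "Factorial_Ring.prime p" "int p dvd ?n"
    then obtain N where N: "ord c = p * N" by auto
    let ?a = "c [^] int N"
    have a: "?a \<in> carrier G" using c by simp
    have "?a [^] p = c [^] int (N * p)" using c by (simp add: int_pow_pow flip: int_pow_int)
    also have "N * p = ord c" using N by simp
    finally have ap: "?a [^] p = \<one>" using c by (simp add: int_pow_int)
    have "h \<otimes> ?a \<otimes> inv h \<in> generate G {?a}" if h: "h \<in> carrier G" for h
    proof -
      have "h \<otimes> c \<otimes> inv h \<in> generate G {c}"
        using Z.inv_op_closed2[OF h] generate.incl[of c "{c}" G] by simp
      then obtain j :: int where "h \<otimes> c \<otimes> inv h = c [^] j" using mem_iff by blast
      then have "h \<otimes> ?a \<otimes> inv h = ?a [^] j"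
        using conj_int_pow[OF h c, of "int N"] c by (simp add: int_pow_pow mult.commute)
      then show ?thesis using mem_generate_singleton_iff[OF a] by blast
    qed
    then have "g \<otimes> ?a = ?a \<otimes> g"
      using nilpotent_normal_prime_order_central[OF nil p(1) a ap _ g(1)] by blast
    then have "c [^] (k * int N) \<otimes> g = c [^] int N \<otimes> g"
      using pow_c[of 1 "int N"] g(1) by simp
    then have "?n dvd int N - k * int N"
      using c g(1) int_pow_eq[OF c] by simp
    then have "int p * int N dvd (1 - k) * int N"
      unfolding N by (simp add: left_diff_distrib)
    moreover have "N \<noteq> 0" using ord_ge_1[OF fin c] N by (intro notI) simp
    ultimately have "int p dvd 1 - k" by simp
    then show "int p dvd k - 1" by (metis dvd_minus_iff minus_diff_eq)
  next
    have "c [^] s \<otimes> c [^] (1::int) = c [^] (k ^ q * 1) \<otimes> c [^] s"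
      using pow_c[of q 1] unfolding s .
    then have "c [^] (s + 1) = c [^] (k ^ q * 1 + s)" unfolding int_pow_mult[OF c] .
    then have "?n dvd k ^ q * 1 + s - (s + 1)" unfolding int_pow_eq[OF c] .
    then show "?n dvd k ^ q - 1" by simp
  next
    have "g \<otimes> g [^] q = g [^] q \<otimes> g" using g(1) nat_pow_Suc2[OF g(1), of q] by simp
    then have "c [^] (k * s) \<otimes> g = c [^] s \<otimes> g"
      using pow_c[of 1 s] g(1) unfolding s by simp
    then have "?n dvd s - k * s" using c g(1) int_pow_eq[OF c] by simp
    then show "?n dvd (k - 1) * s" by (metis dvd_minus_iff left_diff_distrib minus_diff_eq mult_1)
  next
    show "\<not> ?n dvd k - 1"
    proof
      assume "?n dvd k - 1"
      then have "c [^] (1::int) = c [^] k" using int_pow_eq[OF c] by blast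
      then have "g \<otimes> c = c \<otimes> g" using pow_c[of 1 1] c g(1) by simp
      then show False using self_cent g by blast
    qed
  next
    assume "int q dvd ?n"
    then have qn: "q dvd ord c" by simp
    show "\<not> (\<exists>i. ?n dvd i * (\<Sum>j<q. k ^ j) + s)"
    proof
      assume "\<exists>i. ?n dvd i * (\<Sum>j<q. k ^ j) + s"
      then obtain i where i: "?n dvd i * (\<Sum>j<q. k ^ j) + s" by blast
      have "(c [^] i \<otimes> g) [^] q = c [^] (i * (\<Sum>j<q. k ^ j) + s)"
        unfolding twisted_product_power[OF c g(1) k] s int_pow_mult[OF c] ..
      then have "(c [^] i \<otimes> g) [^] q = \<one>" using i int_pow_eq_id[OF c] by simp
      then have "c [^] i \<otimes> g \<in> generate G {c}"
        using prime_order_in_cyclic[OF c q(1) qn] c g(1) by simp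
      then show False by (rule g_mem)
    qed
  qed (use ord_c in simp_all)
  moreover have "(c [^] i \<otimes> g) [^] (2::nat) = c [^] (2 ^ (e - 1) * int m)"
    if i: "?n dvd i * (k + 1) + s - 2 ^ (e - 1) * int m" and "q = 2" for i
  proof -
    have "(c [^] i \<otimes> g) [^] (2::nat) = c [^] (i * (\<Sum>j<2. k ^ j)) \<otimes> c [^] s"
      using twisted_product_power[OF c g(1) k, of i 2] s \<open>q = 2\<close> by simp
    also have "\<dots> = c [^] (i * (k + 1) + s)"
      unfolding int_pow_mult[OF c] by (simp add: numeral_2_eq_2 add.commute)
    also have "\<dots> = c [^] (2 ^ (e - 1) * int m)"
      using i int_pow_eq[OF c] by metis
    finally show ?thesis .
  qed
  ultimately show ?thesis by blast
qed

text \<open>Every element outside the self-centralizing \<open>\<langle>c\<rangle>\<close> is an involution modulo \<open>\<langle>c\<rangle>\<close> acting on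
  \<open>c\<close> by the same exponent, hence \<open>\<langle>c\<rangle>\<close> has index 2.\<close>

lemma cyclic_or_inverting_extension:
  obtains "cyclic_group G"
  | c g e m and k :: int where "c \<in> carrier G" "g \<in> carrier G" "g \<notin> generate G {c}"
    "ord c = 2 ^ e * m" "odd m" "e \<ge> 2"
    "g \<otimes> c \<otimes> inv g = c [^] k" "2 ^ e dvd k + 1" "int m dvd k - 1"
    "g [^] (2::nat) = c [^] (2 ^ (e - 1) * int m)"
    "\<And>h. h \<in> carrier G \<Longrightarrow> h \<in> generate G {c} \<or> (\<exists>z\<in>generate G {c}. h = z \<otimes> g)"
proof -
  obtain c where c: "c \<in> carrier G" and normal: "generate G {c} \<lhd> G"
    and self_cent: "\<And>x. x \<in> carrier G \<Longrightarrow> x \<otimes> c = c \<otimes> x \<Longrightarrow> x \<in> generate G {c}"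
    using self_centralizing_cyclic by blast
  define Z where "Z = generate G {c}"
  interpret Z: normal Z G unfolding Z_def by (rule normal)
  have mem_iff: "z \<in> Z \<longleftrightarrow> (\<exists>i::int. z = c [^] i)" for z
    unfolding Z_def by (rule mem_generate_singleton_iff[OF c])
  show thesis
  proof (cases "carrier G = Z")
    case True
    then have "carrier G = range (\<lambda>n::int. c [^] n)" using mem_iff by blast
    then show thesis using that(1) cyclic_group c by blast
  next
    case False
    then obtain g0 where g0: "g0 \<in> carrier G" "g0 \<notin> Z" using Z.subset by blast
    have "ord c \<noteq> 0" using ord_ge_1[OF fin c] by simp
    obtain e m where ord_c: "ord c = 2 ^ e * m" "odd m"
      by (rule multiplicity_decompose'[of "ord c" 2]) (use \<open>ord c \<noteq> 0\<close> that in auto)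
    have conj_exp: "\<exists>k::int. h \<otimes> c \<otimes> inv h = c [^] k" if "h \<in> carrier G" for h
      using Z.inv_op_closed2[OF that, of c] mem_iff unfolding Z_def by (metis generate.incl insertI1)
    have root: "q = 2 \<and> e \<ge> 2 \<and> 2 ^ e dvd k + 1 \<and> int m dvd k - 1 \<and>
        (\<exists>i::int. (c [^] i \<otimes> h) [^] (2::nat) = c [^] (2 ^ (e - 1) * int m))"
      if "h \<in> carrier G" "h \<notin> Z" "h \<otimes> c \<otimes> inv h = c [^] k"
        "Factorial_Ring.prime q" "h [^] (q::nat) \<in> Z" for h q and k :: int
      by (rule square_root_structure[OF c normal])
        (use self_cent that ord_c in \<open>simp_all add: Z_def\<close>)
    have square: "h [^] (2::nat) \<in> Z" if h: "h \<in> carrier G" "h \<notin> Z" for h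
    proof -
      obtain r :: nat where r: "r > 1" "h [^] r \<in> Z"
        "\<And>p. Factorial_Ring.prime p \<Longrightarrow> p dvd r \<Longrightarrow> h [^] (r div p) \<notin> Z"
        using minimal_root_exponent[OF fin Z.is_subgroup h] by blast
      obtain k :: int where k: "h \<otimes> c \<otimes> inv h = c [^] k" using conj_exp[OF h(1)] by blast
      \<comment> \<open>The element \<open>?h\<close> acts on \<open>c\<close> with the exponent
        \<open>k ^ (r div p)\<close>. So \<open>p = 2\<close> and this power is -1 modulo 4, hence
        not a square, and \<open>r div 2\<close> is odd. As 2 is the only prime divisor of
        \<open>r\<close>, it follows that \<open>r = 2\<close>.\<close>
      have prime_r: "p = 2 \<and> odd (r div 2)" if p: "Factorial_Ring.prime p" "p dvd r" for p
      proof -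
        let ?h = "h [^] (r div p)"
        have "?h \<otimes> c \<otimes> inv ?h = c [^] (k ^ (r div p))"
          using twisted_power[OF c h(1) k, of "r div p" 1] c h(1) by (simp add: m_assoc)
        moreover have "?h [^] p \<in> Z" using p(2) r(2) h(1) by (simp add: nat_pow_pow)
        ultimately have *: "p = 2" "e \<ge> 2" "2 ^ e dvd k ^ (r div p) + 1"
          using root[of ?h "k ^ (r div p)" p] r(3)[OF p] p(1) h(1) by auto
        have "(4::int) dvd 2 ^ e" using le_imp_power_dvd[OF *(2), of "2::int"] by simp
        then have four: "4 dvd k ^ (r div 2) + 1" using *(1,3) dvd_trans by blast
        have "odd (r div 2)"
        proof
          assume "even (r div 2)"
          then obtain t where "r div 2 = t * 2" by (metis evenE mult.commute)
          then have "4 dvd (k ^ t) ^ 2 + 1" using four by (simp add: power_mult)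
          moreover have "(x ^ 2) mod 4 = 0 \<or> (x ^ 2) mod 4 = 1" for x :: int
          proof (cases "even x")
            case True
            then show ?thesis by (auto elim!: evenE simp: power2_eq_square)
          next
            case False
            then obtain y where "x = 2 * y + 1" by (elim oddE)
            then have "x ^ 2 = 4 * (y ^ 2 + y) + 1" by (simp add: power2_eq_square algebra_simps)
            then show ?thesis by presburger
          qed
          moreover have "\<not> (4 dvd y + 1 \<and> (y mod 4 = 0 \<or> y mod 4 = 1))" for y :: int
            by presburger
          ultimately show False by blast
        qed
        then show ?thesis using *(1) by simp
      qed
      obtain p where "Factorial_Ring.prime p" "p dvd r" using prime_factor_nat[of r] r(1) by auto
      then have "even r" "odd (r div 2)" using prime_r by auto
      have "r div 2 = 1"
      proof (rule ccontr)
        assume "r div 2 \<noteq> 1"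
        then obtain p where p: "Factorial_Ring.prime p" "p dvd r div 2" using prime_factor_nat by blast
        then have "p dvd r" using \<open>even r\<close> by (metis dvd_div_mult_self dvd_mult2)
        then show False using prime_r p \<open>odd (r div 2)\<close> by blast
      qed
      then have "r = 2" using \<open>even r\<close> by presburger
      then show ?thesis using r(2) by simp
    qed
    obtain k :: int where k: "g0 \<otimes> c \<otimes> inv g0 = c [^] k" using conj_exp[OF g0(1)] by blast
    obtain i :: int where e: "e \<ge> 2" and k_cong: "2 ^ e dvd k + 1" "int m dvd k - 1"
      and i: "(c [^] i \<otimes> g0) [^] (2::nat) = c [^] (2 ^ (e - 1) * int m)"
      using root[OF g0 k two_is_prime_nat square[OF g0]] by blast
    \<comment> \<open>Within the coset of \<open>g0\<close> this representative squares to the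
      involution of \<open>Z\<close>.\<close>
    define g where "g = c [^] i \<otimes> g0"
    have ci: "c [^] i \<in> Z" using mem_iff by blast
    have g: "g \<in> carrier G" unfolding g_def using c g0(1) by simp
    have gk: "g \<otimes> c \<otimes> inv g = c [^] k"
    proof -
      have "g \<otimes> c \<otimes> inv g = c [^] i \<otimes> (g0 \<otimes> c \<otimes> inv g0) \<otimes> inv (c [^] i)"
        unfolding g_def using c g0(1) by (simp add: inv_mult_group m_assoc)
      also have "\<dots> = c [^] (i + k - i)"
        unfolding k int_pow_diff[OF c] int_pow_mult[OF c] ..
      finally show ?thesis by simp
    qed
    have g_notin: "g \<notin> Z"
    proof
      assume "g \<in> Z"
      then have "inv (c [^] i) \<otimes> g \<in> Z" using ci by simp
      moreover have "inv (c [^] i) \<otimes> g = g0"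
        unfolding g_def using c g0(1) by (simp flip: m_assoc)
      ultimately show False using g0(2) by simp
    qed
    \<comment> \<open>Both \<open>h\<close> and \<open>g\<close> act with exponents that are -1
      modulo \<open>2 ^ e\<close> and 1 modulo \<open>m\<close>, hence in the same way on
      \<open>c\<close>, and \<open>inv g \<otimes> h\<close> centralizes \<open>c\<close>.\<close>
    have cover: "h \<in> Z \<or> (\<exists>z\<in>Z. h = z \<otimes> g)" if h: "h \<in> carrier G" for h
    proof (cases "h \<in> Z")
      case False
      obtain l :: int where l: "h \<otimes> c \<otimes> inv h = c [^] l" using conj_exp[OF h] by blast
      have l_cong: "2 ^ e dvd l + 1" "int m dvd l - 1"
        using root[OF h False l two_is_prime_nat square[OF h False]] by blast+
      have "2 ^ e dvd l - k" using dvd_diff[OF l_cong(1) k_cong(1)] by simp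
      moreover have "int m dvd l - k" using dvd_diff[OF l_cong(2) k_cong(2)] by simp
      moreover have "coprime ((2::int) ^ e) (int m)" using ord_c(2) by simp
      ultimately have "int (ord c) dvd l - k" unfolding ord_c(1) by (simp add: divides_mult)
      then have "c [^] l = c [^] k" using int_pow_eq[OF c] by metis
      then have eq: "h \<otimes> c \<otimes> inv h = g \<otimes> c \<otimes> inv g" unfolding l gk .
      let ?x = "inv g \<otimes> h"
      have "?x \<otimes> c = inv g \<otimes> (h \<otimes> c \<otimes> inv h) \<otimes> h" using g h c by (simp add: m_assoc)
      also have "\<dots> = (inv g \<otimes> g) \<otimes> c \<otimes> ?x" unfolding eq using g h c by (simp only: m_assoc m_closed inv_closed)
      finally have "?x \<otimes> c = c \<otimes> ?x" using g h c by simp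
      then have "?x \<in> Z" using self_cent g h unfolding Z_def by simp
      then have "g \<otimes> ?x \<otimes> inv g \<in> Z" using Z.inv_op_closed2 g by blast
      moreover have "g \<otimes> ?x = h" using g h by (simp flip: m_assoc)
      ultimately have "h \<otimes> inv g \<in> Z" by simp
      moreover have "h = (h \<otimes> inv g) \<otimes> g" using g h by (simp add: m_assoc)
      ultimately show ?thesis by blast
    qed simp
    show thesis
      using that(2)[OF c g g_notin[unfolded Z_def] ord_c e gk k_cong] i cover
      unfolding g_def Z_def by blast
  qed
qed

section \<open>Identification with a quaternion group times a cyclic group\<close>

lemma cyclic_or_quaternion_cyclic:
  "cyclic_group G \<or>
    (\<exists>n m. n \<ge> 3 \<and> odd m \<and> G \<cong> quaternion_group n \<times>\<times> integer_mod_group m)"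
proof (rule cyclic_or_inverting_extension)
  fix c g e m and k :: int
  assume c: "c \<in> carrier G" and g: "g \<in> carrier G" "g \<notin> generate G {c}"
    and ord_c: "ord c = 2 ^ e * m" "odd m" and e: "e \<ge> 2"
    and gk: "g \<otimes> c \<otimes> inv g = c [^] k" and k: "2 ^ e dvd k + 1" "int m dvd k - 1"
    and gg: "g [^] (2::nat) = c [^] (2 ^ (e - 1) * int m)"
    and cover: "\<And>h. h \<in> carrier G \<Longrightarrow> h \<in> generate G {c} \<or> (\<exists>z\<in>generate G {c}. h = z \<otimes> g)"
  have m: "int m > 0" using ord_c(2) by (auto intro: odd_pos)
  have n3: "e + 1 \<ge> 3" using e by simp
  let ?M = "int m" and ?E = "(2::int) ^ e"
  let ?D = "quaternion_group (e + 1) \<times>\<times> integer_mod_group m"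
  \<comment> \<open>Coordinates from the Chinese remainder theorem: \<open>c [^] m\<close> has order
    \<open>2 ^ e\<close> and is inverted by \<open>g\<close>, while \<open>c [^] (2 ^ e)\<close> has
    order \<open>m\<close> and commutes with \<open>g\<close>. The first one plays the rotation, so
    the quaternion parameter is \<open>e + 1\<close>.\<close>
  define C where "C u v = c [^] (?M * u + ?E * v)" for u v :: int
  have C: "C u v \<in> carrier G" for u v unfolding C_def using c by simp
  have ord_int: "int (ord c) = ?E * ?M" using ord_c by simp
  have C_eq_iff: "C u v = C u' v' \<longleftrightarrow> ?E dvd u' - u \<and> ?M dvd v' - v" for u v u' v'
  proof -
    have cop: "coprime ?E ?M" using ord_c(2) by simp
    have "C u v = C u' v' \<longleftrightarrow> ?E * ?M dvd ?M * (u' - u) + ?E * (v' - v)"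
      unfolding C_def int_pow_eq[OF c] ord_int by (simp add: algebra_simps)
    also have "\<dots> \<longleftrightarrow> ?E dvd ?M * (u' - u) + ?E * (v' - v) \<and> ?M dvd ?M * (u' - u) + ?E * (v' - v)"
      using cop by (meson divides_mult dvd_mult_left dvd_mult_right)
    also have "\<dots> \<longleftrightarrow> ?E dvd ?M * (u' - u) \<and> ?M dvd ?E * (v' - v)"
      by (simp add: dvd_add_left_iff dvd_add_right_iff)
    also have "\<dots> \<longleftrightarrow> ?E dvd u' - u \<and> ?M dvd v' - v"
      using cop by (simp add: coprime_dvd_mult_right_iff coprime_commute)
    finally show ?thesis .
  qed
  have C_mod: "C (u mod ?E) (v mod ?M) = C u v" for u v
    unfolding C_eq_iff by (simp flip: mod_eq_dvd_iff)
  have C_mult: "C u v \<otimes> C u' v' = C (u + u') (v + v')" for u v u' v'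
    unfolding C_def using c by (simp add: algebra_simps flip: int_pow_mult)
  have gC: "g \<otimes> C u v = C (- u) v \<otimes> g" for u v
  proof -
    have "g \<otimes> C u v = c [^] (k * (?M * u + ?E * v)) \<otimes> g"
      using twisted_power[OF c g(1) gk, of 1] g(1) unfolding C_def by simp
    also have "k * (?M * u + ?E * v) = ?M * (k * u) + ?E * (k * v)" by (simp add: algebra_simps)
    also have "c [^] \<dots> = C (- u) v"
    proof -
      have "?E dvd (k + 1) * (- u)" "?M dvd (k - 1) * (- v)"
        using dvd_mult2[OF k(1), of "- u"] dvd_mult2[OF k(2), of "- v"] by blast+
      moreover have "(k + 1) * (- u) = - u - k * u" "(k - 1) * (- v) = v - k * v"
        by (simp_all add: algebra_simps)
      ultimately have "?E dvd - u - k * u" "?M dvd v - k * v" by (simp_all only:)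
      then show ?thesis using C_eq_iff[of "k * u" "k * v" "- u" v] unfolding C_def by blast
    qed
    finally show ?thesis .
  qed
  have gg': "g \<otimes> g = C (2 ^ (e - 1)) 0"
    using gg g(1) unfolding C_def by (simp add: numeral_2_eq_2 mult.commute)
  define \<psi> where "\<psi> x = C (fst (fst x)) (snd x) \<otimes> (if snd (fst x) = 1 then g else \<one>)"
    for x :: "(int \<times> int) \<times> int"
  have mem_D: "x \<in> carrier ?D \<longleftrightarrow>
      (\<exists>i a l. x = ((i, a), l) \<and> 0 \<le> i \<and> i < ?E \<and> (a = 0 \<or> a = 1) \<and> 0 \<le> l \<and> l < ?M)" for x
    using m by (cases x) (auto simp: carrier_quaternion_group carrier_integer_mod_group)
  have "\<psi> \<in> iso ?D G"
  proof (rule isoI)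
    show "\<psi> \<in> hom ?D G"
    proof (rule homI)
      show "\<psi> x \<in> carrier G" for x unfolding \<psi>_def using C g(1) by simp
      fix x y assume "x \<in> carrier ?D" "y \<in> carrier ?D"
      then obtain i a l j b l' where xy: "x = ((i, a), l)" "y = ((j, b), l')"
        and ab: "a = 0 \<or> a = 1" "b = 0 \<or> b = 1"
        unfolding mem_D by blast
      have xy_mult: "x \<otimes>\<^bsub>?D\<^esub> y =
        (((i + (if a = 1 then - j else j) + (if a = 1 \<and> b = 1 then 2 ^ (e - 1) else 0)) mod ?E,
          (a + b) mod 2), (l + l') mod ?M)"
        unfolding xy by (simp add: mult_quaternion_group)
      show "\<psi> (x \<otimes>\<^bsub>?D\<^esub> y) = \<psi> x \<otimes> \<psi> y"
      proof (cases "a = 1")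
        case False
        then show ?thesis
          unfolding xy_mult \<psi>_def using ab C g(1) by (auto simp: xy C_mod simp flip: C_mult m_assoc)
      next
        case True
        have "\<psi> x \<otimes> \<psi> y = C i l \<otimes> (g \<otimes> C j l') \<otimes> (if b = 1 then g else \<one>)"
          unfolding \<psi>_def xy using True C g(1) by (simp add: m_assoc)
        also have "\<dots> = C (i - j) (l + l') \<otimes> (g \<otimes> (if b = 1 then g else \<one>))"
          unfolding gC using C g(1) C_mult[of i l "- j" l'] by (simp flip: m_assoc)
        also have "\<dots> = \<psi> (x \<otimes>\<^bsub>?D\<^esub> y)"
          unfolding xy_mult \<psi>_def using ab(2) True C g(1) by (auto simp: C_mod gg' C_mult)
        finally show ?thesis by simp
      qed
    qed
    show "bij_betw \<psi> (carrier ?D) (carrier G)"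
    proof (rule bij_betw_imageI)
      show "inj_on \<psi> (carrier ?D)"
      proof (rule inj_onI)
        fix x y assume "x \<in> carrier ?D" "y \<in> carrier ?D" and eq: "\<psi> x = \<psi> y"
        then obtain i a l j b l' where xy: "x = ((i, a), l)" "y = ((j, b), l')"
          and range: "0 \<le> i" "i < ?E" "0 \<le> l" "l < ?M" "0 \<le> j" "j < ?E" "0 \<le> l'" "l' < ?M"
          and ab: "a = 0 \<or> a = 1" "b = 0 \<or> b = 1"
          unfolding mem_D by blast
        have C_mem: "C u v \<in> generate G {c}" for u v
          unfolding C_def mem_generate_singleton_iff[OF c] by blast
        \<comment> \<open>As \<open>g\<close> is not in the subgroup of \<open>c\<close>, the two
          cosets of this subgroup are disjoint; this makes the second coordinate
          recoverable.\<close>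
        have no: "C u v \<noteq> C u' v' \<otimes> g" for u v u' v'
        proof
          assume "C u v = C u' v' \<otimes> g"
          then have "g = inv (C u' v') \<otimes> C u v" using C g(1) by (simp flip: m_assoc)
          then show False
            using g(2) C_mem subgroup_generate_singleton[OF c]
            by (metis subgroup.m_closed subgroup.m_inv_closed)
        qed
        have "a = b"
        proof (rule ccontr)
          assume "a \<noteq> b"
          then consider "a = 0" "b = 1" | "a = 1" "b = 0" using ab by blast
          then show False
          proof cases
            case 1
            then show False using eq no[of i l j l'] C unfolding \<psi>_def xy by simp
          next
            case 2
            then show False using eq[symmetric] no[of j l' i l] C unfolding \<psi>_def xy by simp
          qed
        qed
        then have "C i l = C j l'"
          using eq right_cancel[OF _ C C, of "if b = 1 then g else \<one>"] g(1) unfolding \<psi>_def xy by simp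
        then have "j mod ?E = i mod ?E" "l' mod ?M = l mod ?M"
          unfolding C_eq_iff mod_eq_dvd_iff by blast+
        then show "x = y" using range \<open>a = b\<close> unfolding xy by simp
      qed
      have C_surj: "\<exists>u v. 0 \<le> u \<and> u < ?E \<and> 0 \<le> v \<and> v < ?M \<and> z = C u v" if z: "z \<in> generate G {c}" for z
      proof -
        obtain t :: int where t: "z = c [^] t" using z mem_generate_singleton_iff[OF c] by blast
        have "coprime ?M ?E" using ord_c(2) by simp
        then obtain p q where pq: "p * ?M + q * ?E = 1" using bezout_int[of ?M ?E] by auto
        have "t = t * (p * ?M + q * ?E)" unfolding pq by simp
        also have "\<dots> = ?M * (t * p) + ?E * (t * q)" by (simp add: algebra_simps)
        finally have "z = C (t * p) (t * q)" unfolding t C_def by (rule arg_cong)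
        then have "z = C (t * p mod ?E) (t * q mod ?M)" by (simp add: C_mod)
        then show ?thesis using m by (intro exI conjI) auto
      qed
      show "\<psi> ` carrier ?D = carrier G"
      proof
        show "\<psi> ` carrier ?D \<subseteq> carrier G" unfolding \<psi>_def using C g(1) by auto
        show "carrier G \<subseteq> \<psi> ` carrier ?D"
        proof
          fix h assume "h \<in> carrier G"
          then obtain u v a where uv: "0 \<le> u" "u < ?E" "0 \<le> v" "v < ?M" "a = 0 \<or> a = 1"
            and h: "h = C u v \<otimes> (if a = (1::int) then g else \<one>)"
          proof (cases "h \<in> generate G {c}")
            case True
            then obtain u v where "0 \<le> u" "u < ?E" "0 \<le> v" "v < ?M" "h = C u v" using C_surj by blast
            then show thesis using that[of u v 0] C by simp
          next
            case False
            then obtain z where "z \<in> generate G {c}" "h = z \<otimes> g"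
              using cover \<open>h \<in> carrier G\<close> by blast
            moreover then obtain u v where "0 \<le> u" "u < ?E" "0 \<le> v" "v < ?M" "z = C u v" using C_surj by blast
            ultimately show thesis using that[of u v 1] by simp
          qed
          have "h = \<psi> ((u, a), v)" unfolding \<psi>_def h by simp
          moreover have "((u, a), v) \<in> carrier ?D" unfolding mem_D using uv by blast
          ultimately show "h \<in> \<psi> ` carrier ?D" by blast
        qed
      qed
    qed
  qed
  moreover have "group ?D"
    using n3 by (intro DirProd_group group_quaternion_group group_integer_mod_group)
  ultimately have "G \<cong> ?D" using group.iso_sym is_isoI by blast
  then show ?thesis using n3 ord_c(2) by blast
qed simp

end

theorem theorem2:
  fixes G :: "('a, 'c) monoid_scheme"
  assumes "group G"
    and "finite (carrier G)"
    and "nilpotent_group G"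
    and "infinite (UNIV :: 'b set)"
  shows "two_closed_group G TYPE('b) \<longleftrightarrow>
           cyclic_group G \<or>
           (\<exists>n m. n \<ge> 3 \<and> odd m \<and>
              G \<cong> DirProd (quaternion_group n) (integer_mod_group m))"
proof
  assume closed: "two_closed_group G TYPE('b)"
  interpret group G by fact
  interpret nilpotent_unique_prime_subgroup G
    by unfold_locales
      (use assms two_closed_prime_order_unique[OF assms(3,2,4) closed] in auto)
  show "cyclic_group G \<or>
           (\<exists>n m. n \<ge> 3 \<and> odd m \<and>
              G \<cong> DirProd (quaternion_group n) (integer_mod_group m))"
    by (rule cyclic_or_quaternion_cyclic)
next
  assume "cyclic_group G \<or>
           (\<exists>n m. n \<ge> 3 \<and> odd m \<and>
              G \<cong> DirProd (quaternion_group n) (integer_mod_group m))"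
  then show "two_closed_group G TYPE('b)"
    using cyclic_imp_two_closed_group quaternion_cyclic_two_closed_group
      two_closed_group_iso assms(1,2) by blast
qed

end
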